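(* Let $0<\alpha<1$ and let $V$ be a random variable uniformly distributed on $(0,1)$. Then for every $x>\alpha(1-\alpha)^{(1-\alpha)/\alpha}$, $$\frac{1}{\pi}a_{1-\alpha}^{-1}(x)=\mathbb{P}\big(a_{1-\alpha}(\pi V)\le x\big) = 2\,H_{2,1}^{1,0}\left[\frac{1}{x^{2\alpha}}\,\Big|_{(0,2)}^{(1,2\alpha),(1,2(1-\alpha))}\right],$$ and $\mathbb{P}(a_{1-\alpha}(\pi V)\le x)=0$ for $x\le \alpha(1-\alpha)^{(1-\alpha)/\alpha}$. Moreover, for $x>\alpha(1-\alpha)^{(1-\alpha)/\alpha}$ the same quantity can be rewritten as $$\frac{1}{\alpha}\, H_{2,1}^{1,0}\left[\frac{1}{x}\,\Big|_{(0,1/\alpha)}^{(1,1),(1,(1-\alpha)/\alpha)}\right] = \frac{1}{1-\alpha}\, H_{2,1}^{1,0}\left[\frac{1}{x^{\alpha/(1-\alpha)}}\,\Big|_{(0,1/(1-\alpha))}^{(1,\alpha/(1-\alpha)),(1,1)}\right].$$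
   Context: For $0<\gamma<1$ and $u\in(0,\pi)$ put $c_\gamma(u)=\frac{\sin(\gamma u)}{\sin u}$, $b_\gamma(u)=[c_\gamma(u)]^{\gamma}[c_{1-\gamma}(u)]^{1-\gamma}$ and $a_\gamma(u)=[b_\gamma(u)]^{1/(1-\gamma)}$. The function $a_\gamma$ is a strictly increasing bijection from $(0,\pi)$ onto $(a_\gamma(0),\infty)$, where $a_\gamma(0):=\lim_{u\to0^+}a_\gamma(u)=(1-\gamma)\gamma^{\gamma/(1-\gamma)}$, and $a_\gamma^{-1}$ denotes its compositional inverse. In particular $a_{1-\alpha}(0)=\alpha(1-\alpha)^{(1-\alpha)/\alpha}$. Fox H-function (the case needed): let $a_1,a_2,b\in\mathbb{R}$ and $A_1,A_2,B>0$ with $B=A_1+A_2$, and put $\beta=B^{B}A_1^{-A_1}A_2^{-A_2}$. For $0<z<\beta$, $$H^{1,0}_{2,1}\left[z\,\Big|_{(b,B)}^{(a_1,A_1),(a_2,A_2)}\right]=\frac{1}{2i\pi}\int_{L_{-\infty}}\frac{\Gamma(b+Bs)}{\Gamma(a_1+A_1s)\,\Gamma(a_2+A_2s)}\,z^{-s}\,ds,$$ where $z^{-s}=e^{-s\log z}$ with the real logarithm and $L_{-\infty}$ is a loop which starts at $-\infty+i\eta_1$, ends at $-\infty+i\eta_2$ (with $\eta_1<0<\eta_2$), and encircles once, counterclockwise, all the poles of $s\mapsto\Gamma(b+Bs)$ (including $s=0$ when $b=0$). *)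

theory Defs
  imports "HOL-Probability.Probability" "HOL-Complex_Analysis.Complex_Analysis"
begin

definition c_fun :: "real \<Rightarrow> real \<Rightarrow> real" where
  "c_fun \<gamma> u = sin (\<gamma> * u) / sin u"

definition b_fun :: "real \<Rightarrow> real \<Rightarrow> real" where
  "b_fun \<gamma> u = c_fun \<gamma> u powr \<gamma> * c_fun (1 - \<gamma>) u powr (1 - \<gamma>)"

definition a_fun :: "real \<Rightarrow> real \<Rightarrow> real" where
  "a_fun \<gamma> u = b_fun \<gamma> u powr (1 / (1 - \<gamma>))"

definition a_inv :: "real \<Rightarrow> real \<Rightarrow> real" where
  "a_inv \<gamma> = the_inv_into {0<..<pi} (a_fun \<gamma>)"

(* A loop L_{-infinity}, parametrised by the whole real line, which starts at
   -infinity + i eta1, ends at -infinity + i eta2 and encircles every point of P once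
   counterclockwise. "Encircles once" means that the truncation of the loop to {s..t},
   closed up by the segment from g t back to g s (which moves off to the left), has
   winding number 1 around the given point once s and t are far enough out. *)
definition left_loop :: "complex set \<Rightarrow> (real \<Rightarrow> complex) \<Rightarrow> bool" where
  "left_loop P g \<longleftrightarrow>
     (\<forall>s t. s < t \<longrightarrow> g piecewise_C1_differentiable_on {s..t}) \<and>
     range g \<inter> P = {} \<and>
     filterlim (\<lambda>t. Re (g t)) at_bot at_bot \<and>
     filterlim (\<lambda>t. Re (g t)) at_bot at_top \<and>
     (\<exists>\<eta>\<^sub>1 \<eta>\<^sub>2. \<eta>\<^sub>1 < 0 \<and> 0 < \<eta>\<^sub>2 \<and>
        ((\<lambda>t. Im (g t)) \<longlongrightarrow> \<eta>\<^sub>1) at_bot \<and> ((\<lambda>t. Im (g t)) \<longlongrightarrow> \<eta>\<^sub>2) at_top) \<and>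
     (\<forall>p\<in>P. \<forall>\<^sub>F (s, t) in at_bot \<times>\<^sub>F at_top.
        winding_number (subpath s t g +++ linepath (g t) (g s)) p = 1)"

(* Improper contour integral along a path parametrised by the whole real line; the two
   ends are truncated independently. *)
definition has_improper_contour_integral ::
    "(complex \<Rightarrow> complex) \<Rightarrow> complex \<Rightarrow> (real \<Rightarrow> complex) \<Rightarrow> bool" where
  "has_improper_contour_integral f I g \<longleftrightarrow>
     (\<forall>s t. s < t \<longrightarrow> f contour_integrable_on subpath s t g) \<and>
     ((\<lambda>(s, t). contour_integral (subpath s t g) f) \<longlongrightarrow> I) (at_bot \<times>\<^sub>F at_top)"

(* At the poles of Gamma in the denominator the quotient is 0, which is the value of the
   entire function 1 / Gamma there, because Gamma is 0 at its poles and x / 0 = 0. *)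
definition fox_integrand ::
    "real \<Rightarrow> real \<times> real \<Rightarrow> real \<times> real \<Rightarrow> real \<times> real \<Rightarrow> complex \<Rightarrow> complex" where
  "fox_integrand z = (\<lambda>(a1, A1) (a2, A2) (b, B) s.
     Gamma (of_real b + of_real B * s) /
       (Gamma (of_real a1 + of_real A1 * s) * Gamma (of_real a2 + of_real A2 * s)) *
     exp (- s * of_real (ln z)))"

definition Gamma_poles :: "real \<times> real \<Rightarrow> complex set" where
  "Gamma_poles = (\<lambda>(b, B). {s. of_real b + of_real B * s \<in> \<int>\<^sub>\<le>\<^sub>0})"

(* fox_H z (a1, A1) (a2, A2) (b, B) is the Fox function H^{1,0}_{2,1}: the common value of
   the integral over all admissible loops. It is only meaningful for A1, A2, B > 0,
   B = A1 + A2 and 0 < z < B powr B * A1 powr (-A1) * A2 powr (-A2). *)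
definition fox_H ::
    "real \<Rightarrow> real \<times> real \<Rightarrow> real \<times> real \<Rightarrow> real \<times> real \<Rightarrow> complex" where
  "fox_H z p1 p2 q =
     (THE h. \<forall>g. left_loop (Gamma_poles q) g \<longrightarrow>
        has_improper_contour_integral (fox_integrand z p1 p2 q) (2 * of_real pi * \<i> * h) g)"

end

theory Submission
  imports Defs "HOL-Real_Asymp.Real_Asymp"
begin

text \<open>
  Put \<open>y = x powr \<alpha>\<close> and \<open>K = \<alpha> powr \<alpha> * (1 - \<alpha>) powr (1 - \<alpha>)\<close>.  After the substitution
  \<open>s \<mapsto> l * s\<close> with \<open>l = 2\<close>, \<open>1 / \<alpha>\<close>, \<open>1 / (1 - \<alpha>)\<close>, the three integrands coincide, and the sum of
  their residues is \<open>1 / l\<close> times the series of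
  \<open>(-1)^n / n! * rGamma (1 - \<alpha> * n) * rGamma (1 - (1 - \<alpha>) * n) / y^n\<close>, which converges for \<open>y > K\<close>
  by a Beta function estimate.  The same estimate, with the reflection formula, makes the integrand
  decay exponentially to the left away from the poles.

  By the reflection formula this series is \<open>1 / pi\<close> times the imaginary part of a Lagrange inversion
  series, namely that of \<open>log v\<close>, where \<open>v\<close> is the root of \<open>1 + v = v powr \<alpha> / y\<close> that comes from
  \<open>v = -1\<close> at \<open>y = \<infinity>\<close>.  Separating real and imaginary parts of the equation shows that the argument
  \<open>u\<close> of \<open>v\<close> satisfies \<open>b_fun (1 - \<alpha>) u = y\<close>, that is \<open>a_fun (1 - \<alpha>) u = x\<close>.
\<close>

section \<open>Lagrange inversion\<close>

text \<open>The constant K is the maximum of t powr \<alpha> * (1 - t) powr (1 - \<alpha>) on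
  [0, 1]. This one fact supplies the growth rate of the coefficients, in place of Stirling's
  formula, and it also forbids a positive real root v, because 1 + v = v powr \<alpha> / y would
  then force y \<le> K. On the side of the Fox function the obstacle is the freedom of the loop: its
  ends may be arbitrarily long and turn back, so the decay of the integrand gives no bound through
  the length of the path. Primitives that vanish at -infinity in half strips give the existence of
  the limit; its value may then be found on conveniently chosen truncations. The Lagrange
  coefficients are found with formal Laurent series, so that analysis enters only once a convergent
  series is at hand.\<close>

lemma fls_residue_inverse_power_times_deriv:
  fixes f :: "'a::field_char_0 fls"
  shows "fls_residue (inverse f ^ (j + 2) * fls_deriv f) = 0"
proof -
  \<comment> \<open>Up to a nonzero integer factor the product is a derivative, and derivatives have
    residue 0.\<close>
  have "fls_deriv (inverse f ^ (j + 1)) = of_int (- int (j + 1)) * (inverse f ^ (j + 2) * fls_deriv f)"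
    unfolding fls_deriv_power fls_inverse_deriv
    by (simp add: power2_eq_square mult_ac del: of_nat_Suc)
  hence "of_int (- int (j + 1)) * fls_residue (inverse f ^ (j + 2) * fls_deriv f) = 0"
    by (metis fls_residue_deriv fls_residue_of_int_times(1))
  thus ?thesis
    by (metis mult_eq_0_iff of_int_eq_0_iff neg_equal_0_iff_equal int_eq_iff add_is_0 one_neq_zero of_nat_0)
qed

lemma fps_to_fls_sum: "fps_to_fls (sum f A) = (\<Sum>x\<in>A. fps_to_fls (f x :: 'a::comm_monoid_add fps))"
  by (induction A rule: infinite_finite_induct) simp_all

text \<open>A formal version of substitution in a contour integral around 0.\<close>

lemma fls_residue_compose:
  fixes D p :: "'a::field_char_0 fps"
  assumes p0: "p $ 0 = 0" and p1: "p $ 1 \<noteq> 0"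
  shows "fls_residue (inverse (fps_to_fls p) ^ Suc n * fps_to_fls ((D oo p) * fps_deriv p)) = D $ n"
proof -
  define f where "f = fps_to_fls p"
  have f_nz: "f \<noteq> 0" using p1 by (auto simp: f_def)
  have inv_pow: "inverse f ^ (i + j) * f ^ j = inverse f ^ i" for i j
    using f_nz by (simp add: power_add field_simps)
  have "subdegree p = 1"
    using p0 p1 by (intro subdegreeI) auto
  hence sub: "fls_subdegree f = 1" by (simp add: f_def fls_subdegree_fls_to_fps)
  \<comment> \<open>\<open>D\<close> is split at degree \<open>n\<close>: the tail cancels the pole
    of order \<open>Suc n\<close>, the degrees below \<open>n\<close> give derivatives of powers of
    \<open>inverse f\<close>, and degree \<open>n\<close> leaves the logarithmic derivative of
    \<open>f\<close>, whose residue is the order 1 of its zero.\<close>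
  define S where "S = fps_shift (Suc n) D"
  have "fps_cutoff (Suc n) D = (\<Sum>k\<le>n. fps_const (D $ k) * fps_X ^ k)"
    by (auto simp: fps_eq_iff fps_sum_nth if_distrib cong: if_cong)
  hence "D = S * fps_X ^ Suc n + (\<Sum>k\<le>n. fps_const (D $ k) * fps_X ^ k)"
    using fps_shift_cutoff[of "Suc n" D] by (simp add: S_def)
  hence "D oo p = (S * fps_X ^ Suc n + (\<Sum>k\<le>n. fps_const (D $ k) * fps_X ^ k)) oo p"
    by (rule arg_cong)
  also have "\<dots> = (S oo p) * p ^ Suc n + (\<Sum>k\<le>n. fps_const (D $ k) * p ^ k)"
    unfolding fps_compose_add_distrib fps_compose_sum_distrib fps_compose_mult_distrib[OF p0]
      fps_compose_power[OF p0, symmetric] fps_X_fps_compose_startby0[OF p0] fps_const_compose ..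
  finally have "D oo p = \<dots>" .
  hence "fps_to_fls ((D oo p) * fps_deriv p) =
      fps_to_fls ((S oo p) * fps_deriv p) * f ^ Suc n + (\<Sum>k\<le>n. fls_const (D $ k) * (f ^ k * fls_deriv f))"
    by (simp add: f_def fls_times_fps_to_fls fps_to_fls_power fls_deriv_fps_to_fls distrib_left distrib_right
        sum_distrib_left mult_ac fps_to_fls_sum)
  hence "inverse f ^ Suc n * fps_to_fls ((D oo p) * fps_deriv p) =
      fps_to_fls ((S oo p) * fps_deriv p) * (inverse f ^ (0 + Suc n) * f ^ Suc n) +
      (\<Sum>k\<le>n. fls_const (D $ k) * ((inverse f ^ (Suc (n - k) + k) * f ^ k) * fls_deriv f))"
    by (simp add: distrib_left sum_distrib_left mult_ac)
  also have "\<dots> = fps_to_fls ((S oo p) * fps_deriv p) +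
      (\<Sum>k\<le>n. fls_const (D $ k) * (inverse f ^ (Suc (n - k)) * fls_deriv f))"
    unfolding inv_pow by simp
  also have "fls_residue \<dots> = (\<Sum>k\<le>n. D $ k * fls_residue (inverse f ^ (Suc (n - k)) * fls_deriv f))"
    by (simp add: fls_nth_sum)
  also have "\<dots> = (\<Sum>k\<le>n. if k = n then D $ n else 0)"
  proof (rule sum.cong)
    fix k assume k: "k \<in> {..n}"
    show "D $ k * fls_residue (inverse f ^ (Suc (n - k)) * fls_deriv f) = (if k = n then D $ n else 0)"
    proof (cases "k = n")
      case True
      thus ?thesis using fls_residue_deriv_times_inverse_eq_subdegree(2)[of f] sub by simp
    next
      case False
      hence "Suc (n - k) = (n - k - 1) + 2" using k by auto
      thus ?thesis using False fls_residue_inverse_power_times_deriv[of f "n - k - 1"] by simp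
    qed
  qed auto
  finally show ?thesis by (simp add: f_def)
qed

text \<open>The logarithm of the solution \<open>w\<close> of \<open>w = 1 + z * w powr a\<close> with \<open>w = 1\<close> at \<open>z = 0\<close>,
  as a power series in \<open>z\<close>; the inverted series is \<open>z\<close> in terms of \<open>w - 1\<close>.\<close>

definition lagrange_series :: "real \<Rightarrow> complex fps" where
  "lagrange_series a = fps_ln 1 oo fps_inv (fps_X * fps_binomial (of_real (-a)))"

text \<open>Both sides solve (1 + X) * F' = c * F with constant term 1.\<close>

lemma fps_exp_compose_ln: "fps_exp c oo fps_ln 1 = fps_binomial (c::complex)"
proof (subst fps_binomial_ODE_unique'[symmetric], intro conjI)
  show "fps_deriv (fps_exp c oo fps_ln 1) = fps_const c * (fps_exp c oo fps_ln 1) / (1 + fps_X)"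
    by (simp add: fps_compose_deriv fps_compose_mult_distrib fps_ln_deriv fps_divide_unit)
qed simp

lemma lagrange_series_0: "lagrange_series a $ 0 = 0"
  by (simp add: lagrange_series_def)

lemma fps_inv_nth_0 [simp]: "fps_inv f $ 0 = 0"
  by (simp add: fps_inv_def)

text \<open>With I the inverse series of p = X * (1 + X) powr (-a), composing exp (c * X) with the
  Lagrange series gives (1 + I) powr c. The claim is thus p(I) = X multiplied by (1 + I) powr
  a.\<close>

lemma lagrange_series_exp:
  "fps_exp 1 oo lagrange_series a = 1 + fps_X * (fps_exp (of_real a) oo lagrange_series a)"
proof -
  define p where "p = fps_X * fps_binomial (of_real (-a) :: complex)"
  define I where "I = fps_inv p"
  have p: "p $ 0 = 0" "p $ 1 \<noteq> 0" by (simp_all add: p_def)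
  have I0: "I $ 0 = 0" by (simp add: I_def)
  have exp_eq: "fps_exp c oo lagrange_series a = fps_binomial c oo I" for c
    unfolding lagrange_series_def p_def[symmetric] I_def[symmetric]
    by (subst fps_compose_assoc) (simp_all add: I0 fps_exp_compose_ln)
  have "fps_X = p oo I" using fps_inv_right[OF p] by (simp add: I_def)
  also have "\<dots> = I * (fps_binomial (of_real (-a)) oo I)"
    unfolding p_def by (simp add: fps_compose_mult_distrib I0)
  finally have "fps_X * (fps_binomial (of_real a) oo I)
      = I * ((fps_binomial (of_real (-a)) * fps_binomial (of_real a)) oo I)"
    by (simp add: fps_compose_mult_distrib I0 mult_ac)
  also have "\<dots> = I" by (simp flip: fps_binomial_add_mult)
  finally show ?thesis
    by (simp add: exp_eq fps_binomial_1 fps_compose_add_distrib I0)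
qed

text \<open>This is Lagrange-Buermann: since L(p) = ln (1 + X), the factor (L' o p) * p' in
  \<open>fls_residue_compose\<close> is just 1 / (1 + X), and the residue becomes a binomial
  coefficient.\<close>

lemma lagrange_series_nth:
  "of_nat (Suc n) * lagrange_series a $ Suc n = (of_real (a * Suc n - 1) gchoose n)"
proof -
  define p where "p = fps_X * fps_binomial (of_real (-a) :: complex)"
  have p: "p $ 0 = 0" "p $ 1 \<noteq> 0" by (simp_all add: p_def)
  have "lagrange_series a oo p = fps_ln 1 oo (fps_inv p oo p)"
    unfolding lagrange_series_def p_def[symmetric]
    by (subst fps_compose_assoc) (use p in simp_all)
  also have "\<dots> = fps_ln 1" by (simp add: fps_inv[OF p])
  finally have C: "lagrange_series a oo p = fps_ln 1" .
  have "fps_deriv (lagrange_series a oo p) = (fps_deriv (lagrange_series a) oo p) * fps_deriv p"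
    by (rule fps_compose_deriv[OF p(1)])
  hence D: "(fps_deriv (lagrange_series a) oo p) * fps_deriv p = fps_binomial (-1)"
    unfolding C by (simp add: fps_ln_deriv fps_binomial_minus_one)
  \<comment> \<open>\<open>B\<close> inverts the unit part of \<open>p ^ Suc n\<close>, so that the
    negative power of \<open>p\<close> is a pure pole in X times a binomial series.\<close>
  define B :: "complex fps" where "B = fps_binomial (of_real (a * Suc n))"
  have "fps_binomial (of_real (-a)) ^ Suc n * B = 1"
    unfolding B_def fps_binomial_power by (simp flip: fps_binomial_add_mult add: algebra_simps)
  hence "fps_to_fls p ^ Suc n * fps_to_fls B = fls_X ^ Suc n"
    unfolding p_def fls_times_fps_to_fls power_mult_distrib
    by (simp flip: fps_to_fls_power fls_times_fps_to_fls add: mult.assoc)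
  moreover have "inverse u = w * inverse v" if "u * w = v" "u \<noteq> 0" "v \<noteq> 0" for u v w :: "complex fls"
    using that by (auto simp: divide_simps mult_ac)
  moreover have "fps_to_fls p ^ Suc n \<noteq> 0" using p by auto
  ultimately have "inverse (fps_to_fls p ^ Suc n) = fps_to_fls B * inverse (fls_X ^ Suc n)"
    using fls_X_pow_nonzero by blast
  hence "inverse (fps_to_fls p) ^ Suc n = fps_to_fls B * inverse fls_X ^ Suc n"
    by (simp only: power_inverse)
  hence "inverse (fps_to_fls p) ^ Suc n * fps_to_fls (fps_binomial (-1)) =
         inverse fls_X ^ Suc n * fps_to_fls (fps_binomial (-1 + of_real (a * Suc n)))"
    by (simp only: B_def fps_binomial_add_mult fls_times_fps_to_fls mult_ac)
  also have "\<dots> = fls_shift (int (Suc n)) (fps_to_fls (fps_binomial (-1 + of_real (a * Suc n))))"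
    by (simp add: fls_inverse_X fls_X_inv_power_times_conv_shift del: power_Suc)
  finally have "fls_residue (inverse (fps_to_fls p) ^ Suc n * fps_to_fls (fps_binomial (-1)))
      = (of_real (a * Suc n - 1) gchoose n)"
    by (simp add: algebra_simps)
  thus ?thesis
    using fls_residue_compose[OF p, of n "fps_deriv (lagrange_series a)"] unfolding D
    by (simp add: fps_deriv_nth)
qed

section \<open>Gamma and Beta function estimates\<close>

text \<open>At every finite stage of the Gauss limit the modulus differs from the value at the real
  part by an explicit product; both bounds on the modulus of Gamma compare its factors one by
  one.\<close>

lemma norm_Gamma_series:
  fixes x y :: real
  assumes "x > 0"
  shows "norm (Gamma_series (Complex x y) n) =
    Gamma_series x n * (\<Prod>k<Suc n. (x + k) / norm (Complex (x + k) y))"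
proof -
  have ph: "pochhammer (Complex x y) (Suc n) = (\<Prod>k<Suc n. Complex (x + k) y)"
    unfolding pochhammer_prod atLeast0LessThan by (intro prod.cong) (auto simp: complex_eq_iff)
  have ph': "pochhammer x (Suc n) = (\<Prod>k<Suc n. x + k)"
    unfolding pochhammer_prod atLeast0LessThan ..
  have nz: "(\<Prod>k<Suc n. x + k) \<noteq> 0" using assms by (subst prod_zero_iff) auto
  have e: "norm (exp (Complex x y * of_real (ln (real n)))) = exp (x * ln (real n))"
    by (simp add: norm_exp_eq_Re)
  show ?thesis
    unfolding Gamma_series_def Suc_eq_plus1[symmetric] ph ph' prod_dividef
      norm_divide norm_mult prod_norm[symmetric]
    using nz e by (simp add: divide_simps del: prod.lessThan_Suc)
qed

lemma norm_Gamma_le: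
  fixes z :: complex
  assumes "Re z > 0"
  shows "norm (Gamma z) \<le> Gamma (Re z)"
proof (rule LIMSEQ_le)
  obtain x y where z: "z = Complex x y" by (cases z)
  have x: "x > 0" using assms by (simp add: z)
  show "(\<lambda>n. norm (Gamma_series z n)) \<longlonglongrightarrow> norm (Gamma z)" by (intro tendsto_intros)
  show "Gamma_series (Re z) \<longlonglongrightarrow> Gamma (Re z)" by (intro tendsto_intros)
  have "norm (Gamma_series z n) \<le> Gamma_series x n" for n
  proof -
    have "(x + k) / norm (Complex (x + k) y) \<le> 1" for k :: nat
      using x complex_Re_le_cmod[of "Complex (x + k) y"] by (simp add: divide_le_eq_1)
    hence "(\<Prod>k<Suc n. (x + k) / norm (Complex (x + k) y)) \<le> 1"
      using x by (intro prod_le_1) auto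
    moreover have "Gamma_series x n \<ge> 0"
      using x by (auto simp: Gamma_series_def intro!: divide_nonneg_nonneg pochhammer_nonneg)
    ultimately show ?thesis
      unfolding z norm_Gamma_series[OF x] by (rule mult_left_le)
  qed
  thus "\<exists>N. \<forall>n\<ge>N. norm (Gamma_series z n) \<le> Gamma_series (Re z) n" by (auto simp: z)
qed

text \<open>The factors \<open>(x + k) / norm (Complex (x + k) y)\<close> of the Gauss product increase with \<open>x\<close>
  and decrease with \<open>\<bar>y\<bar>\<close>, so it suffices to look at the corner \<open>x = 1\<close>, \<open>y = h\<close>.\<close>

lemma norm_Gamma_ge:
  fixes z :: complex
  assumes re: "Re z \<ge> 1" and im: "\<bar>Im z\<bar> \<le> h"
  shows "norm (Gamma z) \<ge> norm (Gamma (Complex 1 h)) * Gamma (Re z)"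
proof (rule LIMSEQ_le)
  obtain x y where z: "z = Complex x y" by (cases z)
  have x: "x \<ge> 1" "x > 0" and y: "\<bar>y\<bar> \<le> h" using assms by (simp_all add: z)
  show "(\<lambda>n. norm (Gamma_series z n)) \<longlonglongrightarrow> norm (Gamma z)" by (intro tendsto_intros)
  \<comment> \<open>Division by \<open>Gamma_series 1 n\<close>, which tends to Gamma 1 = 1,
    isolates the product of the corner factors without changing the limit.\<close>
  show "(\<lambda>n. norm (Gamma_series (Complex 1 h) n) / Gamma_series 1 n * Gamma_series (Re z) n)
      \<longlonglongrightarrow> norm (Gamma (Complex 1 h)) * Gamma (Re z)"
    by (rule tendsto_eq_intros Gamma_series_LIMSEQ | simp)+
  have "norm (Gamma_series (Complex 1 h) n) / Gamma_series 1 n * Gamma_series x n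
      \<le> norm (Gamma_series z n)" for n
  proof -
    have pos: "Gamma_series x n \<ge> 0" "Gamma_series (1::real) n \<ge> 0"
      using x by (auto simp: Gamma_series_def intro!: divide_nonneg_nonneg pochhammer_nonneg)
    have nn: "norm (Gamma_series (Complex 1 h) n) / Gamma_series 1 n
        \<le> (\<Prod>k<Suc n. (1 + real k) / norm (Complex (1 + k) h))"
      unfolding norm_Gamma_series[OF zero_less_one]
      by (cases "Gamma_series (1::real) n = 0") (auto intro!: prod_nonneg simp del: prod.lessThan_Suc)
    have step: "(1 + real k) / norm (Complex (1 + k) h) \<le> (x + k) / norm (Complex (x + k) y)" for k
    proof -
      have hh: "y\<^sup>2 \<le> h\<^sup>2" using y by (simp add: abs_le_square_iff[symmetric])
      have "(1 + real k)\<^sup>2 \<le> (x + k)\<^sup>2" using x by (intro power_mono) auto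
      hence "(1 + real k)\<^sup>2 * y\<^sup>2 \<le> (x + k)\<^sup>2 * h\<^sup>2" using hh by (intro mult_mono) auto
      hence "((1 + real k) * norm (Complex (x + k) y))\<^sup>2 \<le> ((x + k) * norm (Complex (1 + k) h))\<^sup>2"
        unfolding power_mult_distrib cmod_power2 by (simp add: algebra_simps)
      hence le: "(1 + real k) * norm (Complex (x + k) y) \<le> (x + k) * norm (Complex (1 + k) h)"
        by (rule power2_le_imp_le) (use x in auto)
      have "norm (Complex (1 + k) h) > 0" "norm (Complex (x + k) y) > 0"
        using x by (auto simp: complex_eq_iff)
      thus ?thesis using le by (simp add: field_simps)
    qed
    have "(\<Prod>k<Suc n. (1 + real k) / norm (Complex (1 + k) h))
        \<le> (\<Prod>k<Suc n. (x + k) / norm (Complex (x + k) y))"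
      by (intro prod_mono conjI step) auto
    hence "norm (Gamma_series (Complex 1 h) n) / Gamma_series 1 n
        \<le> (\<Prod>k<Suc n. (x + k) / norm (Complex (x + k) y))"
      using nn by (rule order.trans[rotated])
    thus ?thesis
      unfolding z norm_Gamma_series[OF x(2)] using pos(1)
      by (subst mult.commute, intro mult_left_mono) auto
  qed
  thus "\<exists>N. \<forall>n\<ge>N. norm (Gamma_series (Complex 1 h) n) / Gamma_series 1 n * Gamma_series (Re z) n
      \<le> norm (Gamma_series z n)" by (auto simp: z)
qed

text \<open>Equality holds for \<open>u : v = a : (1 - a)\<close>, which is where the constant comes from.\<close>

lemma weighted_AM_GM:
  fixes a u v :: real
  assumes "0 < a" "a < 1" "u \<ge> 0" "v \<ge> 0"
  shows "u powr a * v powr (1 - a) \<le> a powr a * (1 - a) powr (1 - a) * (u + v)"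
proof (cases "u = 0 \<or> v = 0")
  case False
  hence u: "u > 0" "v > 0" using assms by auto
  \<comment> \<open>Jensen for ln with weights a and 1 - a; the points are rescaled so that their
    weighted mean is u + v.\<close>
  have "a * ln (u / a) + (1 - a) * ln (v / (1 - a)) \<le> ln (a * (u / a) + (1 - a) * (v / (1 - a)))"
    using ln_concave assms u unfolding concave_on_def
    by (auto dest!: convex_onD[of _ _ "1 - a" "u / a" "v / (1 - a)"])
  also have "a * (u / a) + (1 - a) * (v / (1 - a)) = u + v" using assms by simp
  finally have "a * ln u + (1 - a) * ln v \<le> a * ln a + (1 - a) * ln (1 - a) + ln (u + v)"
    using assms u by (simp add: ln_div algebra_simps)
  hence "exp (a * ln u + (1 - a) * ln v) \<le> exp (a * ln a + (1 - a) * ln (1 - a) + ln (u + v))"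
    by simp
  thus ?thesis using assms u by (simp add: powr_def exp_add)
qed (use assms in auto)

text \<open>The integrand is the power r - 1 of t powr a * (1 - t) powr (1 - a), which is at most K,
  times the integrand for r = 1. Splitting off that last factor keeps the integrable singularities
  at the ends.\<close>

lemma Beta_scaled_le:
  fixes a r :: real
  assumes "0 < a" "a < 1" "r \<ge> 1"
  shows "Beta (a * r) ((1 - a) * r) \<le> (a powr a * (1 - a) powr (1 - a)) powr (r - 1) * Beta a (1 - a)"
proof (rule has_integral_le)
  define K where "K = a powr a * (1 - a) powr (1 - a)"
  show "((\<lambda>t. t powr (a * r - 1) * (1 - t) powr ((1 - a) * r - 1)) has_integral
      Beta (a * r) ((1 - a) * r)) {0..1}"
    by (rule has_integral_Beta_real) (use assms in auto)
  show "((\<lambda>t. K powr (r - 1) * (t powr (a - 1) * (1 - t) powr ((1 - a) - 1))) has_integral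
      (K powr (r - 1) * Beta a (1 - a))) {0..1}"
    by (intro has_integral_mult_right has_integral_Beta_real) (use assms in auto)
  fix t :: real assume t: "t \<in> {0..1}"
  have "t powr (a * r - 1) * (1 - t) powr ((1 - a) * r - 1) =
      (t powr a * (1 - t) powr (1 - a)) powr (r - 1) * (t powr (a - 1) * (1 - t) powr ((1 - a) - 1))"
    using t by (simp add: powr_mult powr_powr mult_ac flip: powr_add) (simp add: algebra_simps flip: powr_add)
  also have "\<dots> \<le> K powr (r - 1) * (t powr (a - 1) * (1 - t) powr ((1 - a) - 1))"
    using weighted_AM_GM[OF assms(1,2), of t "1 - t"] t assms(3)
    by (intro mult_right_mono powr_mono2) (auto simp: K_def)
  finally show "t powr (a * r - 1) * (1 - t) powr ((1 - a) * r - 1) \<le>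
     K powr (r - 1) * (t powr (a - 1) * (1 - t) powr ((1 - a) - 1))" .
qed

section \<open>The Lagrange series as an analytic function\<close>

lemma rGamma_one_minus_real:
  fixes x :: real
  assumes "x > 0"
  shows "rGamma (1 - x) = Gamma x * sin (pi * x) / pi"
proof -
  have "complex_of_real (rGamma x * rGamma (1 - x)) = of_real (sin (pi * x) / pi)"
    using rGamma_reflection_complex[of "of_real x"]
    using rGamma_complex_of_real[of "1 - x"]
    by (simp add: rGamma_complex_of_real flip: sin_of_real)
  hence "rGamma x * rGamma (1 - x) = sin (pi * x) / pi"
    by (simp only: of_real_eq_iff)
  moreover have "Gamma x * rGamma x = 1"
    using Gamma_real_pos[OF assms] by (simp add: rGamma_inverse_Gamma)
  hence "rGamma (1 - x) = Gamma x * (rGamma x * rGamma (1 - x))"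
    by (simp flip: mult.assoc)
  ultimately show ?thesis by simp
qed

text \<open>\<open>rGamma\<close> is entire, so the Pochhammer quotient stays valid when (1 - a) * n
  is an integer, where the corresponding Gamma value would be at a pole.\<close>

lemma lagrange_series_nth_Gamma:
  assumes "0 < a" "n > 0"
  shows "lagrange_series a $ n = of_real (Gamma (a * n) * rGamma (1 - (1 - a) * n) / fact n)"
proof -
  obtain m where n: "n = Suc m" using assms(2) gr0_conv_Suc by blast
  have pos: "a * n > 0" using assms by simp
  have "rGamma (1 - (1 - a) * n) = pochhammer (1 - (1 - a) * n) m * rGamma (a * n)"
    using pochhammer_rGamma[of "1 - (1 - a) * n" m] by (simp add: n algebra_simps)
  hence p: "pochhammer (1 - (1 - a) * n) m = Gamma (a * n) * rGamma (1 - (1 - a) * n)"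
    using Gamma_real_pos[OF pos] by (simp add: rGamma_inverse_Gamma field_simps)
  have "of_nat n * lagrange_series a $ n = complex_of_real ((a * n - 1) gchoose m)"
    using lagrange_series_nth[of m a] unfolding n by (simp add: gbinomial_prod_rev)
  also have "(a * n - 1) gchoose m = pochhammer (1 - (1 - a) * n) m / fact m"
    unfolding gbinomial_pochhammer' by (simp add: n algebra_simps)
  finally show ?thesis unfolding p by (simp add: n field_simps del: of_nat_Suc)
qed

text \<open>Reflection moves both Gamma arguments to the positive axis. Weakening n! to (n - 1)! =
  Gamma n completes the Beta function of a * n and (1 - a) * n.\<close>

lemma norm_lagrange_series_le:
  assumes "0 < a" "a < 1" "n > 0"
  shows "norm (lagrange_series a $ n) \<le> (a powr a * (1 - a) powr (1 - a)) ^ (n - 1) * Beta a (1 - a)"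
proof -
  obtain m where n: "n = Suc m" using assms(3) gr0_conv_Suc by blast
  have pos: "a * n > 0" "(1 - a) * n > 0" using assms by simp_all
  have K: "a powr a * (1 - a) powr (1 - a) > 0" using assms by simp
  have "norm (lagrange_series a $ n)
      = Gamma (a * n) * \<bar>rGamma (1 - (1 - a) * n)\<bar> / fact n"
    unfolding lagrange_series_nth_Gamma[OF assms(1,3)] norm_of_real
    using Gamma_real_pos[OF pos(1)] by (simp add: abs_mult)
  also have "\<dots> \<le> Gamma (a * n) * Gamma ((1 - a) * n) / fact m"
  proof -
    have "\<bar>rGamma (1 - (1 - a) * n)\<bar> = Gamma ((1 - a) * n) * (\<bar>sin (pi * ((1 - a) * n))\<bar> / pi)"
      unfolding rGamma_one_minus_real[OF pos(2)] using Gamma_real_pos[OF pos(2)] by (simp add: abs_mult)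
    also have "\<bar>sin (pi * ((1 - a) * n))\<bar> / pi \<le> 1"
      using order.trans[OF abs_sin_le_one[of "pi * ((1 - a) * n)"], of pi] pi_gt3
      by (simp add: divide_le_eq_1)
    finally have "\<bar>rGamma (1 - (1 - a) * n)\<bar> \<le> Gamma ((1 - a) * n)"
      using Gamma_real_pos[OF pos(2)] by (simp add: mult_left_le)
    moreover have "fact m \<le> (fact n :: real)" unfolding n by (rule fact_mono) auto
    ultimately show ?thesis using Gamma_real_pos[OF pos(1)] Gamma_real_pos[OF pos(2)]
      by (intro frac_le mult_left_mono) auto
  qed
  also have "\<dots> = Beta (a * n) ((1 - a) * n)"
    using Gamma_fact[of m, where ?'a = real] by (simp add: Beta_def n algebra_simps)
  also have "\<dots> \<le> (a powr a * (1 - a) powr (1 - a)) powr (n - 1) * Beta a (1 - a)"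
    by (rule order.trans[OF Beta_scaled_le]) (use assms in auto)
  also have "(a powr a * (1 - a) powr (1 - a)) powr (n - 1) = (a powr a * (1 - a) powr (1 - a)) ^ (n - 1)"
    using K by (subst powr_realpow[symmetric]) auto
  finally show ?thesis .
qed

lemma lagrange_series_conv_radius:
  assumes "0 < a" "a < 1"
  shows "fps_conv_radius (lagrange_series a) \<ge> ereal (1 / (a powr a * (1 - a) powr (1 - a)))"
  unfolding fps_conv_radius_def
proof (rule conv_radius_geI_ex')
  define K where "K = a powr a * (1 - a) powr (1 - a)"
  have K: "K > 0" using assms by (simp add: K_def)
  fix r :: real assume r: "0 < r" "ereal r < ereal (1 / (a powr a * (1 - a) powr (1 - a)))"
  hence Kr: "K * r < 1" using K by (simp add: K_def[symmetric] field_simps)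
  have "summable (\<lambda>n. Beta a (1 - a) * r * (K * r) ^ n)"
    using Kr K r by (intro summable_mult summable_geometric) auto
  moreover have "norm (lagrange_series a $ Suc n * of_real r ^ Suc n) \<le> Beta a (1 - a) * r * (K * r) ^ n" for n
  proof -
    have "norm (lagrange_series a $ Suc n) * r ^ Suc n \<le> (K ^ n * Beta a (1 - a)) * r ^ Suc n"
      using norm_lagrange_series_le[OF assms, of "Suc n"] r by (intro mult_right_mono) (auto simp: K_def)
    thus ?thesis using r by (simp add: norm_mult norm_power power_mult_distrib mult_ac)
  qed
  ultimately have "summable (\<lambda>n. lagrange_series a $ Suc n * of_real r ^ Suc n)"
    by (rule summable_comparison_test'[of _ 0])
  thus "summable (\<lambda>n. fps_nth (lagrange_series a) n * of_real r ^ n)"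
    using summable_Suc_iff[of "\<lambda>n. lagrange_series a $ n * of_real r ^ n"] by blast
qed

text \<open>The formal identity \<open>lagrange_series_exp\<close> gives equality near 0, and the
  identity theorem extends it to the disc of radius 1 / K.\<close>

lemma exp_lagrange_series:
  assumes "0 < a" "a < 1" and z: "norm z < 1 / (a powr a * (1 - a) powr (1 - a))"
  defines "L \<equiv> eval_fps (lagrange_series a)"
  shows "exp (L z) = 1 + z * exp (of_real a * L z)"
proof -
  define R where "R = 1 / (a powr a * (1 - a) powr (1 - a))"
  have R: "R > 0" using assms by (simp add: R_def)
  have rad: "fps_conv_radius (lagrange_series a) \<ge> ereal R"
    unfolding R_def by (rule lagrange_series_conv_radius) fact+
  hence "fps_conv_radius (lagrange_series a) > 0" using R
    by (metis ereal_less(2) less_le_trans)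
  hence L: "L has_fps_expansion lagrange_series a"
    unfolding L_def by (rule eval_fps_has_fps_expansion)
  have E: "(\<lambda>z. exp (c * L z)) has_fps_expansion (fps_exp c oo lagrange_series a)" for c
    using has_fps_expansion_compose[OF has_fps_expansion_exp L lagrange_series_0, of c]
    by (simp add: o_def)
  define G where "G z = exp (1 * L z) - (1 + z * exp (of_real a * L z))" for z
  have "G has_fps_expansion (fps_exp 1 oo lagrange_series a) -
      (1 + fps_X * (fps_exp (of_real a) oo lagrange_series a))"
    unfolding G_def by (intro fps_expansion_intros E)
  hence "G has_fps_expansion 0" by (simp add: lagrange_series_exp)
  hence "eventually (\<lambda>z. G z = 0) (nhds 0)"
    unfolding has_fps_expansion_def eval_fps_0 by (auto elim!: eventually_mono)
  then obtain S where S: "open S" "0 \<in> S" "\<And>z. z \<in> S \<Longrightarrow> G z = 0"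
    by (auto simp: eventually_nhds)
  have "L holomorphic_on ball 0 R"
    unfolding L_def using rad ball_eball_mono by (intro holomorphic_on_eval_fps) blast
  hence hol: "G holomorphic_on ball 0 R"
    unfolding G_def by (intro holomorphic_intros)
  have "G z = 0"
    by (rule analytic_continuation_open[of "S \<inter> ball 0 R" "ball 0 R" G "\<lambda>_. 0"])
      (use S R hol z in \<open>auto simp: R_def[symmetric]\<close>)
  thus ?thesis by (simp add: G_def)
qed

section \<open>The angle of the root\<close>

lemma sin_nonpos_imp_ge_pi:
  fixes x :: real
  assumes "sin x \<le> 0" "x > 0"
  shows "x \<ge> pi"
  using assms sin_gt_zero[of x] by linarith

text \<open>The hypotheses are the real and imaginary parts of 1 + v = \<zeta> * v powr a for v =
  exp (\<rho> + \<i> * \<theta>), on the branch with argument \<theta>. Cross-multiplying them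
  eliminates \<zeta>; taking logarithms eliminates \<rho>.\<close>

lemma b_fun_eq_inverse:
  assumes a: "0 < a" "a < 1" and \<zeta>: "\<zeta> > 0" and \<theta>: "0 < \<theta>" "\<theta> < 2 * pi"
    and re: "1 + exp \<rho> * cos \<theta> = \<zeta> * exp (a * \<rho>) * cos (a * \<theta>)"
    and im: "exp \<rho> * sin \<theta> = \<zeta> * exp (a * \<rho>) * sin (a * \<theta>)"
  shows "\<theta> < pi \<and> b_fun (1 - a) \<theta> = 1 / \<zeta>"
proof -
  have "(1 + exp \<rho> * cos \<theta>) * sin (a * \<theta>) = (exp \<rho> * sin \<theta>) * cos (a * \<theta>)"
    unfolding re im by simp
  hence "sin (a * \<theta>) = exp \<rho> * (sin \<theta> * cos (a * \<theta>) - cos \<theta> * sin (a * \<theta>))"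
    by (simp add: algebra_simps)
  also have "\<dots> = exp \<rho> * sin (\<theta> - a * \<theta>)" by (simp add: sin_diff)
  also have "\<theta> - a * \<theta> = (1 - a) * \<theta>" by (simp add: algebra_simps)
  finally have sa: "sin (a * \<theta>) = exp \<rho> * sin ((1 - a) * \<theta>)" .
  have pos: "a * \<theta> > 0" "(1 - a) * \<theta> > 0" using a \<theta> by simp_all
  have less: "\<theta> < pi"
  \<comment> \<open>For \<theta> \<ge> pi the sines at a * \<theta> and (1 - a) * \<theta> are both
    nonpositive, so both angles are at least pi, although their sum \<theta> is below 2 *
    pi.\<close>
  proof (rule ccontr)
    assume "\<not> \<theta> < pi"
    hence "sin (2 * pi - \<theta>) \<ge> 0" using \<theta> by (intro sin_ge_zero) auto
    hence "exp \<rho> * sin \<theta> \<le> 0" by (simp add: sin_diff mult_le_0_iff)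
    hence "sin (a * \<theta>) \<le> 0" unfolding im using \<zeta> by (simp add: mult_le_0_iff)
    moreover hence "sin ((1 - a) * \<theta>) \<le> 0" unfolding sa by (simp add: mult_le_0_iff)
    ultimately have "a * \<theta> \<ge> pi" "(1 - a) * \<theta> \<ge> pi" using pos sin_nonpos_imp_ge_pi by blast+
    thus False using \<theta> by (simp add: algebra_simps)
  qed
  define s s1 s2 where "s = sin \<theta>" and "s1 = sin (a * \<theta>)" and "s2 = sin ((1 - a) * \<theta>)"
  have "a * \<theta> < pi" "(1 - a) * \<theta> < pi"
    using mult_strict_mono[of a 1 \<theta> pi] mult_strict_mono[of "1 - a" 1 \<theta> pi] a \<theta> less by auto
  hence s: "s > 0" "s1 > 0" "s2 > 0"
    using less \<theta> pos by (simp_all add: s_def s1_def s2_def sin_gt_zero)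
  have "ln s1 = ln (exp \<rho> * s2)" using sa by (simp add: s1_def s2_def)
  hence l1: "ln s1 = \<rho> + ln s2" using s by (simp add: ln_mult)
  have "ln (exp \<rho> * s) = ln (\<zeta> * exp (a * \<rho>) * s1)" using im by (simp add: s_def s1_def)
  hence l2: "\<rho> + ln s = ln \<zeta> + a * \<rho> + ln s1" using s \<zeta> by (simp add: ln_mult)
  have "b_fun (1 - a) \<theta> = exp ((1 - a) * ln (s2 / s) + a * ln (s1 / s))"
    using s unfolding b_fun_def c_fun_def
    by (simp add: powr_def exp_add flip: s_def s1_def s2_def)
  also have "(1 - a) * ln (s2 / s) + a * ln (s1 / s) = - ln \<zeta>"
    using l1 l2 s by (simp add: ln_div algebra_simps)
  also have "exp (- ln \<zeta>) = 1 / \<zeta>" using \<zeta> by (simp add: exp_minus inverse_eq_divide)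
  finally show ?thesis using less by blast
qed

text \<open>With \<open>\<rho> + \<i> * \<theta>\<close> equal to \<open>\<i> * pi\<close> plus the Lagrange series at \<open>- \<zeta> * cis (pi * a)\<close>,
  the two hypotheses of the previous lemma hold along \<open>0 \<le> \<zeta> < 1 / K\<close>.  The angle starts at \<open>pi\<close>,
  can never reach 0 (weighted AM-GM) nor lie in \<open>[pi, 2 * pi)\<close> for \<open>\<zeta> > 0\<close>, and hence stays in \<open>(0, pi)\<close>.\<close>

lemma angle_series:
  assumes a: "0 < a" "a < 1" and y: "y > a powr a * (1 - a) powr (1 - a)"
  obtains u where "0 < u" "u < pi" "b_fun (1 - a) u = y"
    "(\<lambda>n. (-1) ^ n / fact n * rGamma (1 - a * n) * rGamma (1 - (1 - a) * n) / y ^ n) sums (u / pi)"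
proof -
  define K where "K = a powr a * (1 - a) powr (1 - a)"
  have K: "K > 0" using a by (simp add: K_def)
  have y0: "y > 0" using y K by (simp add: K_def)
  define L where "L = eval_fps (lagrange_series a)"
  \<comment> \<open>On this ray, w = exp (L (\<zeta> * c)) satisfies w = 1 + \<zeta> * c * w powr a;
    then v = -w with argument pi + Im L satisfies 1 + v = \<zeta> * v powr a, the factor cis (pi *
    a) being absorbed by v powr a.\<close>
  define c where "c = - cis (pi * a)"
  define \<theta> where "\<theta> \<zeta> = pi + Im (L (of_real \<zeta> * c))" for \<zeta> :: real
  define \<rho> where "\<rho> \<zeta> = Re (L (of_real \<zeta> * c))" for \<zeta> :: real
  have rad: "fps_conv_radius (lagrange_series a) \<ge> ereal (1 / K)"
    unfolding K_def by (rule lagrange_series_conv_radius) fact+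
  have c: "norm c = 1" by (simp add: c_def)
  have eqs: "1 + exp (\<rho> \<zeta>) * cos (\<theta> \<zeta>) = \<zeta> * exp (a * \<rho> \<zeta>) * cos (a * \<theta> \<zeta>)"
            "exp (\<rho> \<zeta>) * sin (\<theta> \<zeta>) = \<zeta> * exp (a * \<rho> \<zeta>) * sin (a * \<theta> \<zeta>)"
    if \<zeta>: "0 \<le> \<zeta>" "\<zeta> < 1 / K" for \<zeta>
  proof -
    define w where "w = Complex (\<rho> \<zeta>) (\<theta> \<zeta>)"
    have w: "L (of_real \<zeta> * c) = w - \<i> * pi"
      by (simp add: w_def \<rho>_def \<theta>_def complex_eq_iff)
    have "exp (w - \<i> * pi) = 1 + of_real \<zeta> * c * exp (of_real a * (w - \<i> * pi))"
      using exp_lagrange_series[OF a, of "of_real \<zeta> * c"] \<zeta> c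
      by (simp add: norm_mult flip: L_def K_def w)
    moreover have "exp (w - \<i> * pi) = - exp w"
      by (simp add: exp_diff)
    moreover have "exp (of_real a * (w - \<i> * pi)) = exp (of_real a * w) / cis (pi * a)"
      by (simp add: cis_conv_exp right_diff_distrib exp_diff mult_ac)
    ultimately have "1 + exp w = of_real \<zeta> * exp (of_real a * w)"
      by (simp add: c_def algebra_simps add_eq_0_iff)
    thus "1 + exp (\<rho> \<zeta>) * cos (\<theta> \<zeta>) = \<zeta> * exp (a * \<rho> \<zeta>) * cos (a * \<theta> \<zeta>)"
            "exp (\<rho> \<zeta>) * sin (\<theta> \<zeta>) = \<zeta> * exp (a * \<rho> \<zeta>) * sin (a * \<theta> \<zeta>)"
      by (simp_all add: complex_eq_iff w_def Re_exp Im_exp)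
  qed
  have cont: "continuous_on {0..t} \<theta>" if "t < 1 / K" for t
  proof -
    have "of_real x * c \<in> ball 0 (1 / K)" if "x \<in> {0..t}" for x
      using that \<open>t < 1 / K\<close> c by (auto simp: norm_mult)
    hence "of_real x * c \<in> eball 0 (fps_conv_radius (lagrange_series a))" if "x \<in> {0..t}" for x
      using that rad ball_eball_mono by blast
    thus ?thesis unfolding \<theta>_def L_def
      by (intro continuous_intros continuous_on_eval_fps') auto
  qed
  have \<theta>0: "\<theta> 0 = pi" by (simp add: \<theta>_def L_def eval_fps_at_0 lagrange_series_0)
  have no_zero: "\<theta> \<zeta> \<noteq> 0" if \<zeta>: "0 \<le> \<zeta>" "\<zeta> < 1 / K" for \<zeta>
  proof
    assume "\<theta> \<zeta> = 0"
    hence "1 + exp (\<rho> \<zeta>) = \<zeta> * exp (a * \<rho> \<zeta>)" using eqs(1)[OF \<zeta>] by simp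
    moreover have "exp (a * \<rho> \<zeta>) \<le> K * (1 + exp (\<rho> \<zeta>))"
      using weighted_AM_GM[OF a, of "exp (\<rho> \<zeta>)" 1] by (simp add: K_def powr_def add.commute)
    ultimately have "exp (a * \<rho> \<zeta>) * 1 \<le> exp (a * \<rho> \<zeta>) * (K * \<zeta>)" by (simp add: mult_ac)
    hence "1 \<le> K * \<zeta>" by (subst (asm) mult_le_cancel_left_pos) auto
    thus False using \<zeta> K by (simp add: field_simps)
  qed
  define \<zeta> where "\<zeta> = 1 / y"
  have \<zeta>: "0 < \<zeta>" "\<zeta> < 1 / K" using y y0 K by (simp_all add: \<zeta>_def K_def frac_less2)
  have \<theta>_pos: "\<theta> \<zeta> > 0"
  proof (rule ccontr)
    assume "\<not> \<theta> \<zeta> > 0"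
    then obtain t where "0 \<le> t" "t \<le> \<zeta>" "\<theta> t = 0"
      using IVT2'[of \<theta> \<zeta> 0 0] cont[OF \<zeta>(2)] \<theta>0 \<zeta>(1) by auto
    thus False using no_zero[of t] \<zeta> by auto
  qed
  have \<theta>_less: "\<theta> \<zeta> < 2 * pi"
  proof (rule ccontr)
    assume "\<not> \<theta> \<zeta> < 2 * pi"
    \<comment> \<open>Any value strictly between pi and 2 * pi would do: the angle would have to
      attain it at some t > 0, where \<open>b_fun_eq_inverse\<close> excludes it.\<close>
    hence "3 / 2 * pi \<le> \<theta> \<zeta>" using pi_gt_zero by linarith
    then obtain t where t: "0 \<le> t" "t \<le> \<zeta>" "\<theta> t = 3 / 2 * pi"
      using IVT'[of \<theta> 0 "3 / 2 * pi" \<zeta>] cont[OF \<zeta>(2)] \<theta>0 \<zeta>(1) by auto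
    moreover have "t \<noteq> 0" using t \<theta>0 by auto
    moreover have "0 < \<theta> t" "\<theta> t < 2 * pi" "\<theta> t > pi" using t(3) pi_gt_zero by linarith+
    ultimately show False
      using b_fun_eq_inverse[OF a, of t "\<theta> t" "\<rho> t"] eqs[of t] \<zeta> by auto
  qed
  have sol: "\<theta> \<zeta> < pi" "b_fun (1 - a) (\<theta> \<zeta>) = y"
    using b_fun_eq_inverse[OF a \<zeta>(1) \<theta>_pos \<theta>_less eqs] \<zeta> by (auto simp: \<zeta>_def)
  have "of_real \<zeta> * c \<in> eball 0 (fps_conv_radius (lagrange_series a))"
    using less_le_trans[OF _ rad, of "ereal \<zeta>"] \<zeta> c by (simp add: norm_mult)
  hence "(\<lambda>n. lagrange_series a $ n * (of_real \<zeta> * c) ^ n) sums L (of_real \<zeta> * c)"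
    unfolding L_def by (intro sums_eval_fps) simp
  moreover have "\<theta> \<zeta> - pi = Im (L (of_real \<zeta> * c))" by (simp add: \<theta>_def)
  ultimately have "(\<lambda>n. Im (lagrange_series a $ n * (of_real \<zeta> * c) ^ n)) sums (\<theta> \<zeta> - pi)"
    using sums_Im by metis
  \<comment> \<open>The starting angle pi supplies the term n = 0 of the Fox series, since the
    Lagrange series has no constant term.\<close>
  moreover have "(\<lambda>n. if n = 0 then pi else 0) sums pi"
    using sums_single[of 0 "\<lambda>_. pi"] by simp
  ultimately have "(\<lambda>n. ((if n = 0 then pi else 0) + Im (lagrange_series a $ n * (of_real \<zeta> * c) ^ n)) / pi)
      sums ((pi + (\<theta> \<zeta> - pi)) / pi)"
    by (intro sums_divide sums_add)
  moreover have "((if n = 0 then pi else 0) + Im (lagrange_series a $ n * (of_real \<zeta> * c) ^ n)) / pi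
      = (-1) ^ n / fact n * rGamma (1 - a * n) * rGamma (1 - (1 - a) * n) / y ^ n" for n
  proof (cases "n = 0")
    case False
    \<comment> \<open>The imaginary part of the power of c contributes sin (pi * a * n), exactly the
      factor by which reflection turns Gamma (a * n) into pi * rGamma (1 - a * n).\<close>
    hence n: "n > 0" by simp
    have pos: "a * n > 0" using a n by simp
    have "cis (pi * a) ^ n = cis (pi * (a * n))"
      by (subst Complex.DeMoivre, rule arg_cong[of _ _ cis]) simp
    hence "(of_real \<zeta> * c) ^ n = of_real ((-1) ^ n * \<zeta> ^ n) * cis (pi * (a * n))"
      unfolding c_def power_mult_distrib power_minus[of "cis (pi * a)"] by simp
    moreover have Im_scaled: "Im (of_real r * cis t) = r * sin t" for r t by simp
    ultimately have "Im (lagrange_series a $ n * (of_real \<zeta> * c) ^ n) =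
        Gamma (a * n) * rGamma (1 - (1 - a) * n) / fact n * ((-1) ^ n * \<zeta> ^ n) * sin (pi * (a * n))"
      unfolding lagrange_series_nth_Gamma[OF a(1) n] by (simp only: Im_scaled flip: of_real_mult mult.assoc)
    thus ?thesis using n
      by (simp add: rGamma_one_minus_real[OF pos] \<zeta>_def power_divide mult_ac)
  qed (simp add: lagrange_series_0)
  ultimately have "(\<lambda>n. (-1) ^ n / fact n * rGamma (1 - a * n) * rGamma (1 - (1 - a) * n) / y ^ n)
      sums (\<theta> \<zeta> / pi)" by simp
  thus ?thesis using that sol \<theta>_pos by blast
qed

section \<open>Monotonicity and lower bound of \<open>b_fun\<close>\<close>

lemma b_fun_eq_exp:
  assumes "0 < \<gamma>" "\<gamma> < 1" "0 < u" "u < pi"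
  shows "b_fun \<gamma> u = exp (\<gamma> * ln (sin (\<gamma> * u)) + (1 - \<gamma>) * ln (sin ((1 - \<gamma>) * u)) - ln (sin u))"
    and "sin (\<gamma> * u) > 0" "sin ((1 - \<gamma>) * u) > 0" "sin u > 0"
proof -
  have "\<gamma> * u < pi" "(1 - \<gamma>) * u < pi"
    using mult_strict_mono[of \<gamma> 1 u pi] mult_strict_mono[of "1 - \<gamma>" 1 u pi] assms by auto
  thus s: "sin (\<gamma> * u) > 0" "sin ((1 - \<gamma>) * u) > 0" "sin u > 0"
    using assms by (simp_all add: sin_gt_zero)
  have "b_fun \<gamma> u = exp (\<gamma> * ln (sin (\<gamma> * u) / sin u) + (1 - \<gamma>) * ln (sin ((1 - \<gamma>) * u) / sin u))"
    using s unfolding b_fun_def c_fun_def by (simp add: powr_def exp_add)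
  thus "b_fun \<gamma> u = exp (\<gamma> * ln (sin (\<gamma> * u)) + (1 - \<gamma>) * ln (sin ((1 - \<gamma>) * u)) - ln (sin u))"
    using s by (simp add: ln_div algebra_simps)
qed

lemma x_cot_strict_decreasing:
  fixes x y :: real
  assumes "0 < x" "x < y" "y < pi"
  shows "x * cot x > y * cot y"
proof (rule DERIV_neg_imp_decreasing[OF assms(2)])
  fix t assume t: "x \<le> t" "t \<le> y"
  have s: "sin t > 0" using t assms by (intro sin_gt_zero) auto
  have "cos t < cos 0" using t assms by (intro cos_monotone_0_pi) auto
  hence "sin t * cos t < sin t * 1" using s by (intro mult_strict_left_mono) auto
  also have "sin t \<le> t" using t assms by (intro sin_x_le_x) auto
  finally have "sin t * cos t < t" by simp
  hence "(sin t * cos t - t) / (sin t)\<^sup>2 < 0" using s by (simp add: divide_less_0_iff)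
  moreover have "t * (cos t * cos t) + t * (sin t * sin t) = t"
    by (simp flip: distrib_left power2_eq_square)
  hence "((\<lambda>x. x * cot x) has_real_derivative (sin t * cos t - t) / (sin t)\<^sup>2) (at t)"
    using s by (auto intro!: derivative_eq_intros simp: cot_def field_simps power2_eq_square)
  ultimately show "\<exists>y. ((\<lambda>x. x * cot x) has_real_derivative y) (at t) \<and> y < 0" by blast
qed

text \<open>With \<phi>(x) = x * cot x, t times the logarithmic derivative of \<open>b_fun\<close>
  is the average of \<phi>(\<gamma> * t) and \<phi>((1 - \<gamma>) * t) with weights \<gamma> and 1
  - \<gamma>, minus \<phi>(t). It is positive because \<phi> decreases.\<close>

lemma b_fun_strict_mono:
  assumes "0 < \<gamma>" "\<gamma> < 1" and uv: "0 < u" "u < v" "v < pi"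
  shows "b_fun \<gamma> u < b_fun \<gamma> v"
proof -
  define f where "f u = \<gamma> * ln (sin (\<gamma> * u)) + (1 - \<gamma>) * ln (sin ((1 - \<gamma>) * u)) - ln (sin u)" for u
  have "f u < f v"
  proof (rule DERIV_pos_imp_increasing[OF uv(2)])
    fix t assume t: "u \<le> t" "t \<le> v"
    have t': "0 < t" "t < pi" using t uv by auto
    note s = b_fun_eq_exp(2-)[OF assms(1,2) t']
    define d where "d = \<gamma> * (\<gamma> * cot (\<gamma> * t)) + (1 - \<gamma>) * ((1 - \<gamma>) * cot ((1 - \<gamma>) * t)) - cot t"
    have D: "(f has_real_derivative d) (at t)"
      unfolding f_def d_def using s
      by (auto intro!: derivative_eq_intros simp: cot_def mult_ac)
    have "\<gamma> * t * cot (\<gamma> * t) > t * cot t" "(1 - \<gamma>) * t * cot ((1 - \<gamma>) * t) > t * cot t"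
      by (rule x_cot_strict_decreasing; use assms t' in simp)+
    hence "\<gamma> * (\<gamma> * t * cot (\<gamma> * t)) + (1 - \<gamma>) * ((1 - \<gamma>) * t * cot ((1 - \<gamma>) * t)) >
        \<gamma> * (t * cot t) + (1 - \<gamma>) * (t * cot t)"
      using assms by (intro add_strict_mono mult_strict_left_mono) auto
    hence "t * d > 0" by (simp add: d_def algebra_simps)
    hence "d > 0" using t' by (simp add: zero_less_mult_iff)
    thus "\<exists>y. (f has_real_derivative y) (at t) \<and> y > 0" using D by blast
  qed
  moreover have "0 < v" "u < pi" using uv by auto
  ultimately show ?thesis
    using b_fun_eq_exp(1)[OF assms(1,2)] uv by (simp add: f_def)
qed

text \<open>The difference sin (\<gamma> * u) - \<gamma> * sin u vanishes at 0 and increases. This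
  bounds \<open>b_fun\<close> below without a limit at 0.\<close>

lemma c_fun_gt:
  assumes "0 < \<gamma>" "\<gamma> < 1" "0 < u" "u < pi"
  shows "c_fun \<gamma> u > \<gamma>"
proof -
  have "sin (\<gamma> * 0) - \<gamma> * sin 0 < sin (\<gamma> * u) - \<gamma> * sin u"
  proof (rule DERIV_pos_imp_increasing_open[OF assms(3)])
    fix t assume t: "0 < t" "t < u"
    have "\<gamma> * t < 1 * t" using assms t by (intro mult_strict_right_mono) auto
    hence "cos (\<gamma> * t) > cos t" using assms t by (intro cos_monotone_0_pi) auto
    moreover have "((\<lambda>u. sin (\<gamma> * u) - \<gamma> * sin u) has_real_derivative
        \<gamma> * (cos (\<gamma> * t) - cos t)) (at t)"
      by (auto intro!: derivative_eq_intros simp: algebra_simps)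
    ultimately show "\<exists>y. ((\<lambda>u. sin (\<gamma> * u) - \<gamma> * sin u) has_real_derivative y) (at t) \<and> y > 0"
      using assms by (intro exI[of _ "\<gamma> * (cos (\<gamma> * t) - cos t)"]) auto
  qed (intro continuous_intros)
  thus ?thesis using sin_gt_zero[OF assms(3,4)] by (simp add: c_fun_def field_simps)
qed

lemma b_fun_gt:
  assumes "0 < \<gamma>" "\<gamma> < 1" "0 < u" "u < pi"
  shows "b_fun \<gamma> u > \<gamma> powr \<gamma> * (1 - \<gamma>) powr (1 - \<gamma>)"
  unfolding b_fun_def
  using c_fun_gt[of \<gamma> u] c_fun_gt[of "1 - \<gamma>" u] assms
  by (intro mult_strict_mono powr_less_mono2) auto

section \<open>Integrals along left loops\<close>

lemma valid_path_subpath_interval: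
  fixes g :: "real \<Rightarrow> complex"
  assumes "g piecewise_C1_differentiable_on {s..t}" "s < t"
  shows "valid_path (subpath s t g)"
proof -
  let ?f = "\<lambda>x. (t - s) * x + s"
  have "(g \<circ> ?f) piecewise_C1_differentiable_on {0..1}"
  proof (rule piecewise_C1_differentiable_compose)
    show "?f piecewise_C1_differentiable_on {0..1}"
      by (simp add: C1_differentiable_imp_piecewise)
    show "g piecewise_C1_differentiable_on ?f ` {0..1}"
      using assms by (simp add: image_affinity_atLeastAtMost)
    show "\<And>x. finite ({0..1} \<inter> ?f -` {x})"
      using assms(2)
      by (simp add: Int_commute [of "{0..1}"] inj_on_def crossproduct_eq finite_vimage_IntI)
  qed
  thus ?thesis by (auto simp: o_def valid_path_def subpath_def)
qed

text \<open>Both pieces are subpaths of the path \<open>subpath s u g\<close> on [0, 1], cut at the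
  fraction r that corresponds to t.\<close>

lemma contour_integral_subpath_combine_interval:
  fixes g :: "real \<Rightarrow> complex"
  assumes g: "g piecewise_C1_differentiable_on {s..u}" and st: "s < t" "t < u"
    and f: "f contour_integrable_on subpath s u g"
  shows "contour_integral (subpath s u g) f =
    contour_integral (subpath s t g) f + contour_integral (subpath t u g) f"
proof -
  define r where "r = (t - s) / (u - s)"
  have r: "r \<in> {0..1}" and r': "(u - s) * r = t - s" using st by (auto simp: r_def field_simps)
  have "(u - s) * (r * x) = (t - s) * x" for x
    using r' by (metis mult.assoc)
  hence 1: "subpath 0 r (subpath s u g) = subpath s t g"
    by (simp only: subpath_def diff_zero add_0_right)
  have "(u - s) * ((1 - r) * x + r) + s = (u - t) * x + t" for x
    using arg_cong[OF r', of "\<lambda>y. y * (1 - x)"] by (simp add: algebra_simps)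
  hence 2: "subpath r 1 (subpath s u g) = subpath t u g"
    by (simp add: subpath_def)
  have "valid_path (subpath s u g)" using valid_path_subpath_interval[OF g] st by simp
  from contour_integral_subpath_combine[OF f this, of 0 r 1] r show ?thesis
    by (simp add: 1 2)
qed

text \<open>A primitive exists by convexity, and the exponential bound gives it a limit at
  -infinity, uniformly across the strip; subtracting the limit normalises it. Integrals over ends of
  a loop then depend on endpoints only, however long the ends are.\<close>

lemma half_strip_primitive:
  fixes f :: "complex \<Rightarrow> complex" and m :: real
  assumes ab: "a < b" and \<kappa>: "\<kappa> > 0"
  defines "H \<equiv> {w. Re w < m \<and> a < Im w \<and> Im w < b}"
  assumes hol: "f holomorphic_on H"
    and bound: "\<And>w. w \<in> H \<Longrightarrow> norm (f w) \<le> C * exp (\<kappa> * Re w)"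
  obtains F where "\<And>w. w \<in> H \<Longrightarrow> (F has_field_derivative f w) (at w)"
    "\<And>\<epsilon>. \<epsilon> > 0 \<Longrightarrow> \<exists>N. \<forall>w\<in>H. Re w < N \<longrightarrow> norm (F w) < \<epsilon>"
proof -
  have H_eq: "H = {w. Re w < m} \<inter> ({w. Im w > a} \<inter> {w. Im w < b})" by (auto simp: H_def)
  have op: "open H" unfolding H_eq
    by (intro open_Int open_halfspace_Re_lt open_halfspace_Im_gt open_halfspace_Im_lt)
  have cvx: "convex H" unfolding H_eq
    by (intro convex_Int convex_halfspace_Re_lt convex_halfspace_Im_gt convex_halfspace_Im_lt)
  obtain G where G: "\<And>w. w \<in> H \<Longrightarrow> (G has_field_derivative f w) (at w)"
  proof (rule holomorphic_convex_primitive'[OF cvx op hol])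
    fix G assume "\<And>w. w \<in> H \<Longrightarrow> (G has_field_derivative f w) (at w within H)"
    thus thesis using that op by (metis at_within_open)
  qed
  define c where "c = (a + b) / 2"
  define p where "p j = Complex (m - 1 - real j) c" for j
  have p_H: "p j \<in> H" for j using ab by (simp add: p_def H_def c_def)
  have C0: "C \<ge> 0"
    using order.trans[OF norm_ge_zero bound[OF p_H[of 0]]] by (simp add: zero_le_mult_iff)
  have step: "norm (G w - G v) \<le> C * exp (\<kappa> * r) * norm (w - v)"
    if "w \<in> H" "v \<in> H" "Re w \<le> r" "Re v \<le> r" for w v r
  proof -
    have seg: "closed_segment v w \<subseteq> H" using that cvx by (simp add: closed_segment_subset)
    have "(f has_contour_integral (G w - G v)) (linepath v w)"
      using contour_integral_primitive[of H G f "linepath v w"] seg G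
      by (auto intro: has_field_derivative_at_within)
    thus ?thesis
    proof (rule has_contour_integral_bound_linepath)
      show "0 \<le> C * exp (\<kappa> * r)" using C0 by simp
      fix z assume z: "z \<in> closed_segment v w"
      have "closed_segment v w \<subseteq> {z. Re z \<le> r}"
        using that by (intro closed_segment_subset) (auto intro: convex_halfspace_Re_le)
      hence "exp (\<kappa> * Re z) \<le> exp (\<kappa> * r)" using z \<kappa> by auto
      thus "norm (f z) \<le> C * exp (\<kappa> * r)"
        using bound[of z] seg z C0 by (meson mult_left_mono order.trans subsetD)
    qed
  qed
  \<comment> \<open>The points p j march left in unit steps, so the increments of G are dominated by
    a geometric series.\<close>
  have "norm (G (p (Suc j)) - G (p j)) \<le> C * exp (\<kappa> * (m - 1)) * exp (- \<kappa>) ^ j" for j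
  proof -
    have "p (Suc j) - p j = -1" by (simp add: p_def complex_eq_iff)
    hence "norm (G (p (Suc j)) - G (p j)) \<le> C * exp (\<kappa> * (m - 1 - j))"
      using step[OF p_H[of "Suc j"] p_H[of j], of "m - 1 - j"] by (simp add: p_def)
    also have "exp (\<kappa> * (m - 1 - j)) = exp (\<kappa> * (m - 1)) * exp (- \<kappa>) ^ j"
      by (simp add: exp_of_nat_mult[symmetric] exp_add[symmetric] algebra_simps)
    finally show ?thesis by (simp add: mult_ac)
  qed
  moreover have "summable (\<lambda>j. C * exp (\<kappa> * (m - 1)) * exp (- \<kappa>) ^ j)"
    using \<kappa> by (intro summable_mult summable_geometric) auto
  ultimately have "summable (\<lambda>j. G (p (Suc j)) - G (p j))"
    by (rule summable_comparison_test'[rotated])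
  hence "convergent (\<lambda>n. G (p n) - G (p 0))"
    using sum_lessThan_telescope[of "\<lambda>j. G (p j)"] by (simp add: summable_iff_convergent)
  hence "convergent (\<lambda>n. G (p n))"
    by (simp add: convergent_diff_const_right_iff)
  then obtain l where l: "(\<lambda>j. G (p j)) \<longlonglongrightarrow> l"
    by (auto simp: convergent_def)
  show ?thesis
  proof (rule that[of "\<lambda>w. G w - l"])
    fix w assume "w \<in> H"
    thus "((\<lambda>w. G w - l) has_field_derivative f w) (at w)"
      using G by (auto intro!: derivative_eq_intros)
  next
    fix \<epsilon> :: real assume \<epsilon>: "\<epsilon> > 0"
    have "eventually (\<lambda>j. dist (G (p j)) l < \<epsilon> / 2) sequentially"
      using l \<epsilon> by (intro tendstoD) auto
    then obtain J where J: "\<And>j. j \<ge> J \<Longrightarrow> norm (G (p j) - l) < \<epsilon> / 2"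
      by (auto simp: eventually_sequentially dist_norm)
    define D where "D = C * (1 + (b - a))"
    have D0: "D \<ge> 0" using C0 ab by (simp add: D_def)
    have "((\<lambda>r. D * exp (\<kappa> * (r + 1))) \<longlongrightarrow> 0) at_bot"
      using \<kappa> by real_asymp
    hence "eventually (\<lambda>r. D * exp (\<kappa> * (r + 1)) < \<epsilon> / 2) at_bot"
      using \<epsilon> by (intro order_tendstoD) auto
    then obtain N where N: "\<And>r. r \<le> N \<Longrightarrow> D * exp (\<kappa> * (r + 1)) < \<epsilon> / 2"
      by (auto simp: eventually_at_bot_linorder)
    show "\<exists>N. \<forall>w\<in>H. Re w < N \<longrightarrow> norm (G w - l) < \<epsilon>"
    proof (intro exI ballI impI)
      fix w assume w: "w \<in> H" "Re w < min N (m - 1 - real J - 1)"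
      \<comment> \<open>This p j lies to the right of w by less than 1, hence the exponent Re w + 1
        in the estimate.\<close>
      define j where "j = nat \<lfloor>m - 1 - Re w\<rfloor>"
      have j: "real j \<le> m - 1 - Re w" "m - 1 - Re w < real j + 1"
        using w(2) unfolding j_def by linarith+
      have "j \<ge> J" using j w(2) by simp
      have re: "\<bar>Re (w - p j)\<bar> \<le> 1" using j by (simp add: p_def)
      have im: "\<bar>Im (w - p j)\<bar> \<le> b - a" using w(1) ab unfolding p_def H_def c_def by (simp add: abs_le_iff field_simps) linarith
      have nw: "norm (w - p j) \<le> 1 + (b - a)" using cmod_le[of "w - p j"] re im by linarith
      have "norm (G w - G (p j)) \<le> C * exp (\<kappa> * (Re w + 1)) * norm (w - p j)"
        using j by (intro step w p_H) (auto simp: p_def)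
      also have "\<dots> \<le> C * exp (\<kappa> * (Re w + 1)) * (1 + (b - a))"
        using nw C0 by (intro mult_left_mono) auto
      also have "\<dots> = D * exp (\<kappa> * (Re w + 1))" by (simp add: D_def mult_ac)
      also have "\<dots> < \<epsilon> / 2" using N w(2) by simp
      finally show "norm (G w - l) < \<epsilon>"
        using J[OF \<open>j \<ge> J\<close>] norm_triangle_ineq[of "G w - G (p j)" "G (p j) - l"] by simp
    qed
  qed
qed

text \<open>Eventually the two ends stay in half strips below and above the real axis, where the
  normalised primitives tend to 0. This yields the limit for independent truncations without
  identifying it.\<close>

lemma left_loop_integral_tendsto:
  fixes f :: "complex \<Rightarrow> complex"
  assumes P: "closed P" and hol: "f holomorphic_on - P" and \<kappa>: "\<kappa> > 0"
    and decay: "\<And>h \<delta>. 0 < \<delta> \<Longrightarrow> \<exists>C R. \<forall>w. Re w \<le> R \<longrightarrow> \<bar>Im w\<bar> \<le> h \<longrightarrow> \<delta> \<le> \<bar>Im w\<bar> \<longrightarrow>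
        w \<notin> P \<and> norm (f w) \<le> C * exp (\<kappa> * Re w)"
    and loop: "left_loop P g"
  shows "\<forall>s t. s < t \<longrightarrow> f contour_integrable_on subpath s t g"
    and "\<exists>I. ((\<lambda>(s, t). contour_integral (subpath s t g) f) \<longlongrightarrow> I) (at_bot \<times>\<^sub>F at_top)"
proof -
  have gC1: "\<And>s t. s < t \<Longrightarrow> g piecewise_C1_differentiable_on {s..t}"
    and avoid: "range g \<inter> P = {}"
    and re_bot: "filterlim (\<lambda>t. Re (g t)) at_bot at_bot"
    and re_top: "filterlim (\<lambda>t. Re (g t)) at_bot at_top"
    using loop by (auto simp: left_loop_def)
  obtain \<eta>1 \<eta>2 where \<eta>: "\<eta>1 < 0" "0 < \<eta>2"
    "((\<lambda>t. Im (g t)) \<longlongrightarrow> \<eta>1) at_bot" "((\<lambda>t. Im (g t)) \<longlongrightarrow> \<eta>2) at_top"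
    using loop by (auto simp: left_loop_def)
  have intble: "f contour_integrable_on subpath s t g" if "s < t" for s t
    by (rule contour_integrable_holomorphic_simple[OF hol])
      (use P avoid that valid_path_subpath_interval[OF gC1] in \<open>auto simp: path_image_subpath\<close>)
  thus "\<forall>s t. s < t \<longrightarrow> f contour_integrable_on subpath s t g" by blast
  \<comment> \<open>The asymptotes of the two ends lie strictly between distance \<delta> and
    distance h from the real axis.\<close>
  define \<delta> h where "\<delta> = min (- \<eta>1) \<eta>2 / 2" and "h = max (- \<eta>1) \<eta>2 + 1"
  have \<delta>: "\<delta> > 0" "\<delta> < h" "\<delta> < \<eta>2" "\<eta>2 < h" "- h < \<eta>1" "\<eta>1 < - \<delta>"
    using \<eta>(1,2) by (auto simp: \<delta>_def h_def min_def max_def)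
  obtain C R where CR: "\<And>w. Re w \<le> R \<Longrightarrow> \<bar>Im w\<bar> \<le> h \<Longrightarrow> \<delta> \<le> \<bar>Im w\<bar> \<Longrightarrow>
      w \<notin> P \<and> norm (f w) \<le> C * exp (\<kappa> * Re w)"
    using decay[OF \<delta>(1), of h] by blast
  define H1 H2 where "H1 = {w. Re w < R \<and> - h < Im w \<and> Im w < - \<delta>}"
    and "H2 = {w. Re w < R \<and> \<delta> < Im w \<and> Im w < h}"
  have CR': "w \<notin> P \<and> norm (f w) \<le> C * exp (\<kappa> * Re w)" if "w \<in> H1 \<union> H2" for w
    using that \<delta> by (intro CR) (auto simp: H1_def H2_def)
  hence "f holomorphic_on H1" "f holomorphic_on H2"
    using hol by (auto intro: holomorphic_on_subset)
  note prim = this[unfolded H1_def H2_def]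
  obtain F1 where F1: "\<And>w. w \<in> H1 \<Longrightarrow> (F1 has_field_derivative f w) (at w)"
      "\<And>\<epsilon>. \<epsilon> > 0 \<Longrightarrow> \<exists>N. \<forall>w\<in>H1. Re w < N \<longrightarrow> norm (F1 w) < \<epsilon>"
    using half_strip_primitive[OF _ \<kappa> prim(1), of C] CR' \<delta> unfolding H1_def H2_def by auto
  obtain F2 where F2: "\<And>w. w \<in> H2 \<Longrightarrow> (F2 has_field_derivative f w) (at w)"
      "\<And>\<epsilon>. \<epsilon> > 0 \<Longrightarrow> \<exists>N. \<forall>w\<in>H2. Re w < N \<longrightarrow> norm (F2 w) < \<epsilon>"
    using half_strip_primitive[OF _ \<kappa> prim(2), of C] CR' \<delta> unfolding H1_def H2_def by auto
  have re_less: "eventually (\<lambda>t. Re (g t) < N) at_bot" "eventually (\<lambda>t. Re (g t) < N) at_top" for N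
    using re_bot re_top by (auto simp: filterlim_at_bot_dense)
  have ev1: "eventually (\<lambda>t. g t \<in> H1) at_bot" unfolding H1_def mem_Collect_eq
    using \<delta> by (intro eventually_conj re_less order_tendstoD[OF \<eta>(3)]) auto
  have ev2: "eventually (\<lambda>t. g t \<in> H2) at_top" unfolding H2_def mem_Collect_eq
    using \<delta> by (intro eventually_conj re_less order_tendstoD[OF \<eta>(4)]) auto
  obtain T2 where T2: "\<And>t. t \<ge> T2 \<Longrightarrow> g t \<in> H2"
    using ev2 by (auto simp: eventually_at_top_linorder)
  obtain T where "\<And>t. t \<le> T \<Longrightarrow> g t \<in> H1"
    using ev1 by (auto simp: eventually_at_bot_linorder)
  then obtain T1 where T1: "T1 < T2" "\<And>t. t \<le> T1 \<Longrightarrow> g t \<in> H1"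
    by (metis linorder_not_le order.trans linear lt_ex)
  have lim1: "((\<lambda>t. F1 (g t)) \<longlongrightarrow> 0) at_bot"
  proof (rule tendstoI)
    fix \<epsilon> :: real assume "\<epsilon> > 0"
    then obtain N where N: "\<forall>w\<in>H1. Re w < N \<longrightarrow> norm (F1 w) < \<epsilon>" using F1(2) by blast
    show "eventually (\<lambda>t. dist (F1 (g t)) 0 < \<epsilon>) at_bot"
      using ev1 re_less(1)[of N] by eventually_elim (use N in auto)
  qed
  have lim2: "((\<lambda>t. F2 (g t)) \<longlongrightarrow> 0) at_top"
  proof (rule tendstoI)
    fix \<epsilon> :: real assume "\<epsilon> > 0"
    then obtain N where N: "\<forall>w\<in>H2. Re w < N \<longrightarrow> norm (F2 w) < \<epsilon>" using F2(2) by blast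
    show "eventually (\<lambda>t. dist (F2 (g t)) 0 < \<epsilon>) at_top"
      using ev2 re_less(2)[of N] by eventually_elim (use N in auto)
  qed
  define J where "J = contour_integral (subpath T1 T2 g) f"
  have int1: "contour_integral (subpath s T1 g) f = F1 (g T1) - F1 (g s)" if "s < T1" for s
  proof -
    have "(f has_contour_integral (F1 (pathfinish (subpath s T1 g)) - F1 (pathstart (subpath s T1 g))))
        (subpath s T1 g)"
      by (rule contour_integral_primitive[of H1])
        (use F1(1) T1(2) that valid_path_subpath_interval[OF gC1[OF that] that] in
          \<open>auto simp: path_image_subpath intro: has_field_derivative_at_within\<close>)
    thus ?thesis by (simp add: contour_integral_unique)
  qed
  have int2: "contour_integral (subpath T2 t g) f = F2 (g t) - F2 (g T2)" if "T2 < t" for t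
  proof -
    have "(f has_contour_integral (F2 (pathfinish (subpath T2 t g)) - F2 (pathstart (subpath T2 t g))))
        (subpath T2 t g)"
      by (rule contour_integral_primitive[of H2])
        (use F2(1) T2 that valid_path_subpath_interval[OF gC1[OF that] that] in
          \<open>auto simp: path_image_subpath intro: has_field_derivative_at_within\<close>)
    thus ?thesis by (simp add: contour_integral_unique)
  qed
  have split: "contour_integral (subpath s t g) f = (F1 (g T1) - F1 (g s)) + J + (F2 (g t) - F2 (g T2))"
    if "s < T1" "T2 < t" for s t
    using contour_integral_subpath_combine_interval[of g s t T1 f]
      contour_integral_subpath_combine_interval[of g T1 t T2 f] gC1 intble that T1(1)
    by (auto simp: int1 int2 J_def)
  have "((\<lambda>x. (F1 (g T1) - F1 (g (fst x))) + J + (F2 (g (snd x)) - F2 (g T2))) \<longlongrightarrow>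
      (F1 (g T1) - 0) + J + (0 - F2 (g T2))) (at_bot \<times>\<^sub>F at_top)"
    by (intro tendsto_intros filterlim_compose[OF lim1] filterlim_compose[OF lim2]
        filterlim_fst filterlim_snd)
  moreover have "eventually (\<lambda>x. (F1 (g T1) - F1 (g (fst x))) + J + (F2 (g (snd x)) - F2 (g T2)) =
      (case x of (s, t) \<Rightarrow> contour_integral (subpath s t g) f)) (at_bot \<times>\<^sub>F at_top)"
    using eventually_prodI[OF eventually_gt_at_bot[of T1] eventually_gt_at_top[of T2]]
    by eventually_elim (auto simp: split)
  ultimately show "\<exists>I. ((\<lambda>(s, t). contour_integral (subpath s t g) f) \<longlongrightarrow> I) (at_bot \<times>\<^sub>F at_top)"
    using Lim_transform_eventually by blast
qed

text \<open>The pole set of s \<mapsto> Gamma (l * s), common to the three functions with l = 2, 1 /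
  \<alpha>, 1 / (1 - \<alpha>).\<close>

definition scaled_nonpos_Ints :: "real \<Rightarrow> complex set" where
  "scaled_nonpos_Ints l = {s. of_real l * s \<in> \<int>\<^sub>\<le>\<^sub>0}"

lemma scaled_nonpos_Ints_eq:
  assumes "l > 0"
  shows "scaled_nonpos_Ints l = range (\<lambda>n. - of_real (real n / l))"
proof (intro equalityI subsetI)
  fix s assume "s \<in> scaled_nonpos_Ints l"
  then obtain n :: nat where "of_real l * s = - of_nat n"
    by (auto simp: scaled_nonpos_Ints_def elim!: nonpos_Ints_cases')
  hence "s = - of_real (real n / l)" using assms by (simp add: field_simps)
  thus "s \<in> range (\<lambda>n. - of_real (real n / l))" by blast
qed (use assms in \<open>auto simp: scaled_nonpos_Ints_def\<close>)

lemma closed_scaled_nonpos_Ints: "closed (scaled_nonpos_Ints l)"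
proof -
  have "closed ((\<lambda>s. of_real l * s) -` (\<int>\<^sub>\<le>\<^sub>0 :: complex set))"
    by (intro closed_vimage continuous_intros) auto
  thus ?thesis by (simp add: scaled_nonpos_Ints_def vimage_def)
qed

text \<open>The two ends of the loop are cut off at the same abscissa halfway between two poles, so that the
  closing segment contributes little.  The winding numbers are eventually 1 only for each pole
  separately; uniformity in the poles holds because far to the left the closed path meets the real
  axis only on the closing segment, so the winding number is constant on both sides of it.\<close>

lemma left_loop_has_improper_contour_integral:
  fixes f :: "complex \<Rightarrow> complex" and r :: "nat \<Rightarrow> complex"
  assumes l: "l > 0" and \<kappa>: "\<kappa> > 0"
    and hol: "f holomorphic_on - scaled_nonpos_Ints l"
    and decay: "\<And>h \<delta>. 0 < \<delta> \<Longrightarrow> \<exists>C R. \<forall>w. Re w \<le> R \<longrightarrow> \<bar>Im w\<bar> \<le> h \<longrightarrow>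
        \<delta> \<le> \<bar>Im w\<bar> \<or> (\<exists>k::nat. Re w = - (real k + 1 / 2) / l) \<longrightarrow> norm (f w) \<le> C * exp (\<kappa> * Re w)"
    and res: "\<And>n. residue f (- of_real (real n / l)) = r n"
    and S: "r sums S"
    and loop: "left_loop (scaled_nonpos_Ints l) g"
  shows "has_improper_contour_integral f (2 * of_real pi * \<i> * S) g"
proof -
  define P where "P = scaled_nonpos_Ints l"
  define p where "p n = - complex_of_real (real n / l)" for n
  have P_eq: "P = range p" by (simp add: P_def p_def[abs_def] scaled_nonpos_Ints_eq[OF l])
  have P_Im: "Im w = 0" if "w \<in> P" for w using that by (auto simp: P_eq p_def)
  have P_Re: "\<exists>n. Re w = - real n / l" if "w \<in> P" for w using that by (auto simp: P_eq p_def)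
  have decay': "\<exists>C R. \<forall>w. Re w \<le> R \<longrightarrow> \<bar>Im w\<bar> \<le> h \<longrightarrow> \<delta> \<le> \<bar>Im w\<bar> \<longrightarrow>
        w \<notin> P \<and> norm (f w) \<le> C * exp (\<kappa> * Re w)" if "0 < \<delta>" for h \<delta>
    using decay[OF that, of h] P_Im that by fastforce
  note ex = left_loop_integral_tendsto[OF _ hol \<kappa> decay'[unfolded P_def] loop, OF closed_scaled_nonpos_Ints]
  obtain I where I: "((\<lambda>(s, t). contour_integral (subpath s t g) f) \<longlongrightarrow> I) (at_bot \<times>\<^sub>F at_top)"
    using ex(2) by blast
  have gC1: "\<And>s t. s < t \<Longrightarrow> g piecewise_C1_differentiable_on {s..t}"
    and avoid: "range g \<inter> P = {}"
    and re_bot: "filterlim (\<lambda>t. Re (g t)) at_bot at_bot"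
    and re_top: "filterlim (\<lambda>t. Re (g t)) at_bot at_top"
    and wind: "\<And>q. q \<in> P \<Longrightarrow> \<forall>\<^sub>F (s, t) in at_bot \<times>\<^sub>F at_top.
        winding_number (subpath s t g +++ linepath (g t) (g s)) q = 1"
    using loop by (auto simp: left_loop_def P_def)
  obtain \<eta>1 \<eta>2 where \<eta>: "\<eta>1 < 0" "0 < \<eta>2"
    "((\<lambda>t. Im (g t)) \<longlongrightarrow> \<eta>1) at_bot" "((\<lambda>t. Im (g t)) \<longlongrightarrow> \<eta>2) at_top"
    using loop by (auto simp: left_loop_def)
  have cont: "continuous_on {s..t} g" if "s < t" for s t
    using gC1[OF that] by (simp add: piecewise_C1_differentiable_on_def)
  define h where "h = max (- \<eta>1) \<eta>2 + 1"
  have h: "h > 0" "\<eta>2 < h" "- h < \<eta>1"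
    using \<eta>(1,2) by (auto simp: h_def min_def max_def)
  obtain C R where CR: "\<And>w k. Re w \<le> R \<Longrightarrow> \<bar>Im w\<bar> \<le> h \<Longrightarrow> Re w = - (real k + 1 / 2) / l \<Longrightarrow>
      norm (f w) \<le> C * exp (\<kappa> * Re w)"
    using decay[OF zero_less_one, of h] by metis
  have "eventually (\<lambda>t. - h < Im (g t) \<and> Im (g t) < 0) at_bot"
    using h \<eta> by (intro eventually_conj order_tendstoD[OF \<eta>(3)]) auto
  then obtain T where T: "\<And>t. t \<le> T \<Longrightarrow> - h < Im (g t) \<and> Im (g t) < 0"
    by (auto simp: eventually_at_bot_linorder)
  have "eventually (\<lambda>t. 0 < Im (g t) \<and> Im (g t) < h) at_top"
    using h \<eta> by (intro eventually_conj order_tendstoD[OF \<eta>(4)]) auto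
  then obtain T2 where T2: "\<And>t. t \<ge> T2 \<Longrightarrow> 0 < Im (g t) \<and> Im (g t) < h"
    by (auto simp: eventually_at_top_linorder)
  define T1 where "T1 = min T (T2 - 1)"
  have T1: "T1 < T2" "\<And>t. t \<le> T1 \<Longrightarrow> - h < Im (g t) \<and> Im (g t) < 0"
    using T by (auto simp: T1_def)
  have bounded_below: "\<exists>N::nat. \<forall>w\<in>A. Re w > - real N / l" if "compact A" for A :: "complex set"
  proof -
    obtain b where b: "\<And>w. w \<in> A \<Longrightarrow> norm w \<le> b"
      using compact_imp_bounded[OF \<open>compact A\<close>] by (auto simp: bounded_iff)
    obtain N :: nat where "b * l < N" using reals_Archimedean2 by blast
    hence "b < real N / l" using l by (simp add: field_simps)
    hence "Re w > - real N / l" if "w \<in> A" for w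
      using b[OF that] abs_Re_le_cmod[of w] by simp
    thus ?thesis by blast
  qed
  \<comment> \<open>Real points left of -M / l are off the loop: its middle part lies to their right
    and its two ends do not meet the real axis.\<close>
  obtain M where M: "\<And>t. t \<in> {T1..T2} \<Longrightarrow> Re (g t) > - real M / l"
    using bounded_below[of "g ` {T1..T2}"] compact_continuous_image[OF cont[OF T1(1)]] by (metis compact_Icc imageI)

  have "(\<lambda>k. 2 * of_real pi * \<i> * (\<Sum>n<Suc k. r n)) \<longlonglongrightarrow> I"
  proof (rule tendstoI)
    fix \<epsilon> :: real assume \<epsilon>: "\<epsilon> > 0"
    \<comment> \<open>Only finitely many winding conditions can be imposed at once. Pole number Suc
      M is the first one left of the middle part, and its winding number spreads to the further
      poles up to the closing segment.\<close>
    have "\<forall>\<^sub>F x in at_bot \<times>\<^sub>F at_top. \<forall>n\<in>{..Suc M}. case x of (s, t) \<Rightarrow>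
        winding_number (subpath s t g +++ linepath (g t) (g s)) (p n) = 1"
      using wind by (intro eventually_ball_finite) (auto simp: P_eq)
    moreover have "\<forall>\<^sub>F x in at_bot \<times>\<^sub>F at_top.
        dist (case x of (s, t) \<Rightarrow> contour_integral (subpath s t g) f) I < \<epsilon> / 2"
      using I \<epsilon> by (intro tendstoD) auto
    ultimately have "\<forall>\<^sub>F x in at_bot \<times>\<^sub>F at_top. case x of (s, t) \<Rightarrow>
        (\<forall>n\<le>Suc M. winding_number (subpath s t g +++ linepath (g t) (g s)) (p n) = 1) \<and>
        dist (contour_integral (subpath s t g) f) I < \<epsilon> / 2"
      by eventually_elim auto
    then obtain Q1 Q2 where Q: "eventually Q1 at_bot" "eventually Q2 at_top"
      "\<And>s t. Q1 s \<Longrightarrow> Q2 t \<Longrightarrow>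
        (\<forall>n\<le>Suc M. winding_number (subpath s t g +++ linepath (g t) (g s)) (p n) = 1) \<and>
        dist (contour_integral (subpath s t g) f) I < \<epsilon> / 2"
      unfolding eventually_prod_filter by auto
    obtain S0 where S0: "\<And>s. s \<le> S0 \<Longrightarrow> Q1 s" "S0 < T1"
      using Q(1) unfolding eventually_at_bot_linorder by (metis linear lt_ex order.trans order.strict_trans1)
    obtain T0 where T0: "\<And>t. t \<ge> T0 \<Longrightarrow> Q2 t" "T0 > T2"
      using Q(2) unfolding eventually_at_top_linorder by (metis linear gt_ex order.trans order.strict_trans2)
    define x where "x k = - (real k + 1 / 2) / l" for k :: nat
    have x_lim: "filterlim x at_bot sequentially"
      unfolding x_def using l by real_asymp
    have "((\<lambda>y. C * exp (\<kappa> * y) * (2 * h)) \<longlongrightarrow> 0) at_bot"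
      using \<kappa> by real_asymp
    hence "eventually (\<lambda>y. C * exp (\<kappa> * y) * (2 * h) < \<epsilon> / 2) at_bot"
      using \<epsilon> by (intro order_tendstoD) auto
    \<comment> \<open>S0 and T0 are fixed before k: once the line Re = x k lies left of g S0 and g
      T0, the intermediate value theorem finds crossings of it beyond both.\<close>
    hence "eventually (\<lambda>y. y < Re (g S0) \<and> y < Re (g T0) \<and> y \<le> R \<and> C * exp (\<kappa> * y) * (2 * h) < \<epsilon> / 2) at_bot"
      by (intro eventually_conj) auto
    hence "eventually (\<lambda>k. x k < Re (g S0) \<and> x k < Re (g T0) \<and> x k \<le> R \<and>
        C * exp (\<kappa> * x k) * (2 * h) < \<epsilon> / 2) sequentially"
      using x_lim by (auto simp: filterlim_iff)
    thus "\<forall>\<^sub>F k in sequentially. dist (2 * of_real pi * \<i> * (\<Sum>n<Suc k. r n)) I < \<epsilon>"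
      using eventually_gt_at_top[of "Suc M"]
    proof eventually_elim
      case (elim k)
      have "eventually (\<lambda>t. Re (g t) < x k) at_top"
        using re_top by (auto simp: filterlim_at_bot_dense)
      then obtain t' where "Re (g t') < x k" "t' > T0"
        using eventually_happens'[OF _ eventually_conj[OF _ eventually_gt_at_top[of T0]]]
          trivial_limit_at_top_linorder by blast
      hence "\<exists>t. T0 \<le> t \<and> t \<le> t' \<and> Re (g t) = x k"
        using elim cont[of T0 t'] by (intro IVT2') (auto intro!: continuous_intros)
      then obtain t where t: "t \<ge> T0" "Re (g t) = x k" by blast
      have "eventually (\<lambda>t. Re (g t) < x k) at_bot"
        using re_bot by (auto simp: filterlim_at_bot_dense)
      then obtain s' where "Re (g s') < x k" "s' < S0"
        using eventually_happens'[OF _ eventually_conj[OF _ eventually_gt_at_bot[of S0]]]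
          trivial_limit_at_bot_linorder by blast
      hence "\<exists>s. s' \<le> s \<and> s \<le> S0 \<and> Re (g s) = x k"
        using elim cont[of s' S0] by (intro IVT') (auto intro!: continuous_intros)
      then obtain s where s: "s \<le> S0" "Re (g s) = x k" by blast
      have st: "s < T1" "T2 < t" "s < t" using s t S0 T0 T1 by auto
      define \<gamma> where "\<gamma> = subpath s t g +++ linepath (g t) (g s)"
      have Q': "winding_number \<gamma> (p n) = 1" if "n \<le> Suc M" for n
        using Q(3)[of s t] s t S0 T0 that by (auto simp: \<gamma>_def)
      have Q'': "dist (contour_integral (subpath s t g) f) I < \<epsilon> / 2"
        using Q(3)[of s t] s t S0 T0 by auto
      have vp: "valid_path (subpath s t g)" using valid_path_subpath_interval gC1 st by blast
      have vp\<gamma>: "valid_path \<gamma>" "pathfinish \<gamma> = pathstart \<gamma>"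
        unfolding \<gamma>_def using vp by (auto intro!: valid_path_join)
      have img: "path_image \<gamma> = g ` {s..t} \<union> closed_segment (g t) (g s)"
        unfolding \<gamma>_def using st by (subst path_image_join) (auto simp: path_image_subpath)
      have seg: "Re z = x k \<and> \<bar>Im z\<bar> \<le> h" if "z \<in> closed_segment (g t) (g s)" for z
      proof -
        have "convex ({z. Re z = x k} \<inter> {z. Im z \<ge> - h} \<inter> {z. Im z \<le> h})"
          by (intro convex_Int convex_halfspace_Im_ge convex_halfspace_Im_le)
            (auto simp: convex_def algebra_simps simp flip: distrib_right)
        moreover have "{g t, g s} \<subseteq> {z. Re z = x k} \<inter> {z. Im z \<ge> - h} \<inter> {z. Im z \<le> h}"
          using s t T2[of t] T1(2)[of s] st h by auto
        ultimately have "closed_segment (g t) (g s) \<subseteq> {z. Re z = x k} \<inter> {z. Im z \<ge> - h} \<inter> {z. Im z \<le> h}"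
          by (intro closed_segment_subset) auto
        thus ?thesis using that by (auto simp: abs_le_iff)
      qed
      have x_ne: "x k \<noteq> - real n / l" for n
      proof
        assume "x k = - real n / l"
        hence "real k + 1 / 2 = real n" using l unfolding x_def by (simp only: divide_cancel_right) auto
        hence "2 * real k + 1 = 2 * real n" by simp
        hence "2 * k + 1 = 2 * n" by linarith
        thus False by presburger
      qed
      have seg_P: "closed_segment (g t) (g s) \<subseteq> - P" using seg P_Re x_ne by force
      have img_P: "path_image \<gamma> \<subseteq> - P" unfolding img using avoid seg_P by auto
      have int_seg: "f contour_integrable_on linepath (g t) (g s)"
        by (rule contour_integrable_holomorphic_simple[OF hol])
          (use closed_scaled_nonpos_Ints seg_P in \<open>auto simp: P_def\<close>)
      have "norm (contour_integral (linepath (g t) (g s)) f) \<le> (C * exp (\<kappa> * x k)) * norm (g s - g t)"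
      proof (rule contour_integral_bound_linepath[OF int_seg])
        have *: "norm (f z) \<le> C * exp (\<kappa> * x k)" if "z \<in> closed_segment (g t) (g s)" for z
          using CR[of z k] seg[OF that] elim by (simp add: x_def)
        thus "norm (f z) \<le> C * exp (\<kappa> * x k)" if "z \<in> closed_segment (g t) (g s)" for z
          using that .
        show "0 \<le> C * exp (\<kappa> * x k)" using order.trans[OF norm_ge_zero *[of "g t"]] by simp
      qed
      also have "\<dots> \<le> (C * exp (\<kappa> * x k)) * (2 * h)"
      proof (rule mult_left_mono)
        have "norm (g s - g t) \<le> \<bar>Re (g s - g t)\<bar> + \<bar>Im (g s - g t)\<bar>" by (rule cmod_le)
        also have "\<dots> \<le> 2 * h" using s t T2[of t] T1(2)[of s] st by simp
        finally show "norm (g s - g t) \<le> 2 * h" .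
        have "norm (f (g t)) \<le> C * exp (\<kappa> * x k)"
          using CR[of "g t" k] seg[of "g t"] elim by (simp add: x_def)
        thus "0 \<le> C * exp (\<kappa> * x k)" using norm_ge_zero order.trans by blast
      qed
      also have "\<dots> < \<epsilon> / 2" using elim by simp
      finally have seg_small: "norm (contour_integral (linepath (g t) (g s)) f) < \<epsilon> / 2" .
      have real_off: "w \<notin> path_image \<gamma>" if w: "Im w = 0" "Re w < - real M / l" "Re w \<noteq> x k" for w
      proof
        assume "w \<in> path_image \<gamma>"
        then obtain u where u: "u \<in> {s..t}" "w = g u" using w(3) seg unfolding img by blast
        show False
        proof (cases "u \<in> {T1..T2}")
          case True
          thus False using M[of u] u w(2) by auto
        next
          case False
          thus False using T1(2)[of u] T2[of u] u w(1) by force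
        qed
      qed
      have "compact (path_image \<gamma>)" using vp\<gamma> by (simp add: compact_path_image valid_path_imp_path)
      then obtain N0 where N0: "\<And>w. w \<in> path_image \<gamma> \<Longrightarrow> Re w > - real N0 / l"
        using bounded_below by blast
      \<comment> \<open>H contains the closed path and exactly the poles p n with n < N. The bound
        Suc (Suc k) puts p N strictly left of the closing segment, while p N itself lies outside H
        and so has winding number 0.\<close>
      define N where "N = max N0 (Suc (Suc k))"
      have N: "Re w > - real N / l" if "w \<in> path_image \<gamma>" for w
        using N0[OF that] l by (simp add: N_def field_simps max_def split: if_splits)
      define H where "H = {w. Re w > - real N / l}"
      have H: "open H" "convex H" "path_image \<gamma> \<subseteq> H"
        using N by (auto simp: H_def open_halfspace_Re_gt convex_halfspace_Re_gt)
      have wind_eq: "winding_number \<gamma> w = winding_number \<gamma> w'"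
        if "Im w = 0" "Im w' = 0" "Re w \<in> {u..v}" "Re w' \<in> {u..v}" "v < - real M / l" "x k \<notin> {u..v}" for w w' u v
      proof (rule winding_number_eq)
        show "connected ({w. Im w = 0} \<inter> {w. Re w \<ge> u} \<inter> {w. Re w \<le> v})"
          by (intro convex_connected convex_Int convex_halfspace_Re_ge convex_halfspace_Re_le)
            (auto simp: convex_def)
        show "({w. Im w = 0} \<inter> {w. Re w \<ge> u} \<inter> {w. Re w \<le> v}) \<inter> path_image \<gamma> = {}"
          using that real_off by fastforce
      qed (use that vp\<gamma> valid_path_imp_path in auto)
      have out: "winding_number \<gamma> w = 0" if "w \<notin> H" for w
        using H vp\<gamma> that by (intro winding_number_zero_outside[of _ H]) (auto simp: valid_path_imp_path)
      have Ip: "Im (p n) = 0" and Rp: "Re (p n) = - real n / l" for n by (simp_all add: p_def)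
      have half: "real k + 1 / 2 \<le> real j \<longleftrightarrow> k < j" "real j \<le> real k + 1 / 2 \<longleftrightarrow> j \<le> k" for j
        by linarith+
      have cmp: "- real i / l \<le> - real j / l \<longleftrightarrow> j \<le> i" "- real i / l < - real j / l \<longleftrightarrow> j < i"
        "x k \<le> - real j / l \<longleftrightarrow> j \<le> k" "- real j / l \<le> x k \<longleftrightarrow> k < j" for i j
        unfolding x_def divide_le_cancel divide_less_cancel using l half[of j] by auto
      have wind_p: "winding_number \<gamma> (p n) = (if n < Suc k then 1 else 0)" if "n < N" for n
      proof (cases "n \<le> Suc M")
        case True
        thus ?thesis using Q' elim by simp
      next
        case False
        show ?thesis
        proof (cases "n < Suc k")
          case True
          have "winding_number \<gamma> (p n) = winding_number \<gamma> (p (Suc M))"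
            by (rule wind_eq[of _ _ "- real k / l" "- real (Suc M) / l"])
              (use False True in \<open>simp_all only: Ip Rp atLeastAtMost_iff cmp\<close>, auto)
          thus ?thesis using Q'[of "Suc M"] True by simp
        next
          case k: False
          have "winding_number \<gamma> (p n) = winding_number \<gamma> (p N)"
            by (rule wind_eq[of _ _ "- real N / l" "- real (Suc k) / l"])
              (use k that elim in \<open>simp_all only: Ip Rp atLeastAtMost_iff cmp\<close>, auto simp: N_def)
          also have "\<dots> = 0" by (rule out) (simp add: H_def p_def)
          finally show ?thesis using k by simp
        qed
      qed
      have inj: "inj p" using l by (auto simp: p_def inj_on_def)
      have HP: "H - p ` {..<N} = H \<inter> - P"
        using l by (auto simp: P_eq H_def p_def field_simps)
      have "contour_integral \<gamma> f =
          2 * pi * \<i> * (\<Sum>q\<in>p ` {..<N}. winding_number \<gamma> q * residue f q)"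
        by (rule Residue_theorem[of H])
          (use H vp\<gamma> out img_P hol HP in \<open>auto simp: convex_connected P_def intro: holomorphic_on_subset\<close>)
      also have "(\<Sum>q\<in>p ` {..<N}. winding_number \<gamma> q * residue f q) =
          (\<Sum>n<N. winding_number \<gamma> (p n) * residue f (p n))"
        using inj by (subst sum.reindex) (auto intro: inj_on_subset)
      also have "\<dots> = (\<Sum>n<N. if n < Suc k then r n else 0)"
        by (intro sum.cong) (auto simp: wind_p res[folded p_def])
      also have "\<dots> = (\<Sum>n<Suc k. r n)"
        by (rule sum.mono_neutral_cong_right) (auto simp: N_def)
      also have "contour_integral \<gamma> f =
          contour_integral (subpath s t g) f + contour_integral (linepath (g t) (g s)) f"
        unfolding \<gamma>_def using ex(1) st int_seg vp by (intro contour_integral_join) auto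
      finally have "2 * of_real pi * \<i> * (\<Sum>n<Suc k. r n) - I =
          (contour_integral (subpath s t g) f - I) + contour_integral (linepath (g t) (g s)) f"
        by simp
      hence "dist (2 * of_real pi * \<i> * (\<Sum>n<Suc k. r n)) I \<le>
          norm (contour_integral (subpath s t g) f - I) + norm (contour_integral (linepath (g t) (g s)) f)"
        by (metis dist_norm norm_triangle_ineq)
      thus ?case using Q'' seg_small by (simp add: dist_norm)
    qed
  qed
  moreover have "(\<lambda>k. 2 * of_real pi * \<i> * (\<Sum>n<Suc k. r n)) \<longlonglongrightarrow> 2 * of_real pi * \<i> * S"
    using S unfolding sums_def by (intro tendsto_intros LIMSEQ_Suc)
  ultimately have "I = 2 * of_real pi * \<i> * S" by (rule LIMSEQ_unique)
  thus ?thesis using I ex(1) by (auto simp: has_improper_contour_integral_def)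
qed

section \<open>An explicit loop and uniqueness of the Fox value\<close>

lemma Ln_minus_upper: "Im z > 0 \<Longrightarrow> Ln (- z) = Ln z - \<i> * pi"
  by (subst Ln_minus) (auto simp: complex_eq_iff)

lemma Ln_minus_lower: "Im z < 0 \<Longrightarrow> Ln (- z) = Ln z + \<i> * pi"
  by (subst Ln_minus) (auto simp: complex_eq_iff)

text \<open>The definite description in \<open>fox_H\<close> is unique only because some admissible loop exists.\<close>

lemma left_loop_exists:
  assumes "P \<subseteq> {z. Im z = 0 \<and> Re z \<le> 0}"
  shows "\<exists>g. left_loop P g"
proof -
  \<comment> \<open>A parabola-like curve that meets the real axis only at 1, to the right of all
    poles, with asymptotes at height -pi / 2 and pi / 2.\<close>
  define g where "g t = Complex (1 - t\<^sup>2) (arctan t)" for t :: real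
  have Im0: "Im (g t) = 0 \<Longrightarrow> Re (g t) = 1" for t
    by (simp add: g_def)
  have der: "(g has_vector_derivative Complex (- 2 * t) (1 / (1 + t\<^sup>2))) (at t)" for t
    unfolding g_def has_vector_derivative_complex_iff
    by (auto intro!: derivative_eq_intros simp: inverse_eq_divide)
  have C1: "g C1_differentiable_on S" for S
    unfolding C1_differentiable_on_def
  proof (intro exI conjI ballI)
    show "(g has_vector_derivative Complex (- 2 * t) (1 / (1 + t\<^sup>2))) (at t)" for t by (rule der)
    have "1 + t\<^sup>2 \<noteq> 0" for t :: real by (metis add_pos_nonneg less_numeral_extra(1,3) zero_le_power2)
    thus "continuous_on S (\<lambda>t. Complex (- 2 * t) (1 / (1 + t\<^sup>2)))"
      unfolding Complex_eq by (intro continuous_intros) auto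
  qed
  have re_bot: "filterlim (\<lambda>t. Re (g t)) at_bot at_bot" and re_top: "filterlim (\<lambda>t. Re (g t)) at_bot at_top"
    by (simp_all add: g_def) real_asymp+
  \<comment> \<open>Two branches of the logarithm suffice: Ln (w - p) on the loop, which avoids the
    ray left of p, and Ln (-(w - p)) on the closing segment, left of p. Passing between them
    contributes \<i> * pi at each joint.\<close>
  have wind: "winding_number (subpath s t g +++ linepath (g t) (g s)) p = 1"
    if p: "p \<in> P" and st: "s < 0" "0 < t" "Re (g s) < Re p" "Re (g t) < Re p" for p s t
  proof -
    have Im_p: "Im p = 0" "Re p \<le> 0" using p assms by auto
    have vp: "valid_path (subpath s t g)"
      using C1 st by (intro valid_path_subpath_interval C1_differentiable_imp_piecewise) auto
    define S1 where "S1 = {w. w - p \<notin> \<real>\<^sub>\<le>\<^sub>0}"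
    have img1: "path_image (subpath s t g) \<subseteq> S1"
    proof
      fix w assume "w \<in> path_image (subpath s t g)"
      then obtain u where "w = g u" using st by (auto simp: path_image_subpath)
      thus "w \<in> S1" using Im0[of u] Im_p by (auto simp: S1_def complex_nonpos_Reals_iff)
    qed
    have 1: "((\<lambda>w. 1 / (w - p)) has_contour_integral (Ln (g t - p) - Ln (g s - p))) (subpath s t g)"
    proof -
      have "((\<lambda>w. 1 / (w - p)) has_contour_integral
         (Ln (pathfinish (subpath s t g) - p) - Ln (pathstart (subpath s t g) - p))) (subpath s t g)"
        by (rule contour_integral_primitive[OF _ vp img1])
          (auto simp: S1_def inverse_eq_divide intro!: derivative_eq_intros)
      thus ?thesis by simp
    qed
    define S2 where "S2 = {w. Re w < Re p}"
    have img2: "path_image (linepath (g t) (g s)) \<subseteq> S2"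
      using st convex_halfspace_Re_lt[of "Re p"]
      by (simp add: S2_def closed_segment_subset)
    have 2: "((\<lambda>w. 1 / (w - p)) has_contour_integral (Ln (- (g s - p)) - Ln (- (g t - p)))) (linepath (g t) (g s))"
    proof -
      have "((\<lambda>w. 1 / (w - p)) has_contour_integral
         (Ln (- (pathfinish (linepath (g t) (g s)) - p)) - Ln (- (pathstart (linepath (g t) (g s)) - p))))
         (linepath (g t) (g s))"
      proof (rule contour_integral_primitive[OF _ _ img2])
        fix x assume "x \<in> S2"
        hence "- (x - p) \<notin> \<real>\<^sub>\<le>\<^sub>0" "x \<noteq> p" by (auto simp: S2_def complex_nonpos_Reals_iff)
        thus "((\<lambda>w. Ln (- (w - p))) has_field_derivative 1 / (x - p)) (at x within S2)"
          by (auto intro!: derivative_eq_intros simp: field_simps)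
      qed auto
      thus ?thesis by simp
    qed
    have im: "Im (g t - p) > 0" "Im (g s - p) < 0" using st Im_p by (auto simp: g_def)
    have "((\<lambda>w. 1 / (w - p)) has_contour_integral
        (Ln (g t - p) - Ln (g s - p)) + (Ln (- (g s - p)) - Ln (- (g t - p))))
        (subpath s t g +++ linepath (g t) (g s))"
      by (rule has_contour_integral_join[OF 1 2 vp]) auto
    also have "(Ln (g t - p) - Ln (g s - p)) + (Ln (- (g s - p)) - Ln (- (g t - p))) = 2 * pi * \<i>"
      using im by (simp only: Ln_minus_upper Ln_minus_lower) (simp add: algebra_simps)
    finally have int: "contour_integral (subpath s t g +++ linepath (g t) (g s)) (\<lambda>w. 1 / (w - p)) = 2 * pi * \<i>"
      by (rule contour_integral_unique)
    have "p \<notin> S1" "p \<notin> S2" by (auto simp: S1_def S2_def)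
    hence "p \<notin> path_image (subpath s t g +++ linepath (g t) (g s))"
      using img1 img2 by (subst path_image_join) auto
    thus ?thesis using int vp
      by (subst winding_number_valid_path) (auto intro!: valid_path_join)
  qed
  have "left_loop P g"
    unfolding left_loop_def
  proof (intro conjI allI impI ballI)
    show "g piecewise_C1_differentiable_on {s..t}" for s t
      by (rule C1_differentiable_imp_piecewise[OF C1])
    show "range g \<inter> P = {}" using assms Im0 by fastforce
    show "filterlim (\<lambda>t. Re (g t)) at_bot at_bot" "filterlim (\<lambda>t. Re (g t)) at_bot at_top"
      by (fact re_bot re_top)+
    show "\<exists>\<eta>\<^sub>1 \<eta>\<^sub>2. \<eta>\<^sub>1 < 0 \<and> 0 < \<eta>\<^sub>2 \<and>
        ((\<lambda>t. Im (g t)) \<longlongrightarrow> \<eta>\<^sub>1) at_bot \<and> ((\<lambda>t. Im (g t)) \<longlongrightarrow> \<eta>\<^sub>2) at_top"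
      unfolding g_def complex.sel
      by (intro exI[of _ "- (pi / 2)"] exI[of _ "pi / 2"] conjI tendsto_arctan_at_bot tendsto_arctan_at_top) auto
    fix p assume p: "p \<in> P"
    have "eventually (\<lambda>s. Re (g s) < Re p) at_bot" "eventually (\<lambda>s. Re (g s) < Re p) at_top"
      using re_bot re_top by (auto simp: filterlim_at_bot_dense)
    hence "eventually (\<lambda>s. s < 0 \<and> Re (g s) < Re p) at_bot" "eventually (\<lambda>s. 0 < s \<and> Re (g s) < Re p) at_top"
      by (auto intro: eventually_conj)
    from eventually_prodI[OF this]
    show "\<forall>\<^sub>F (s, t) in at_bot \<times>\<^sub>F at_top. winding_number (subpath s t g +++ linepath (g t) (g s)) p = 1"
      by eventually_elim (auto simp: wind[OF p])
  qed
  thus ?thesis by blast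
qed

lemma fox_H_eqI:
  assumes "\<And>g. left_loop (Gamma_poles q) g \<Longrightarrow>
      has_improper_contour_integral (fox_integrand z p1 p2 q) (2 * of_real pi * \<i> * h) g"
    and "\<exists>g. left_loop (Gamma_poles q) g"
  shows "fox_H z p1 p2 q = h"
  unfolding fox_H_def
proof (rule the_equality)
  show "\<forall>g. left_loop (Gamma_poles q) g \<longrightarrow>
      has_improper_contour_integral (fox_integrand z p1 p2 q) (2 * of_real pi * \<i> * h) g"
    using assms(1) by blast
  fix h' assume h': "\<forall>g. left_loop (Gamma_poles q) g \<longrightarrow>
      has_improper_contour_integral (fox_integrand z p1 p2 q) (2 * of_real pi * \<i> * h') g"
  obtain g where g: "left_loop (Gamma_poles q) g" using assms(2) by blast
  have "(at_bot \<times>\<^sub>F at_top :: (real \<times> real) filter) \<noteq> bot"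
    by (simp add: prod_filter_eq_bot)
  hence "2 * of_real pi * \<i> * h' = 2 * of_real pi * \<i> * h"
    using assms(1)[OF g] h' g unfolding has_improper_contour_integral_def
    by (blast intro: tendsto_unique)
  thus "h' = h" by simp
qed

section \<open>Evaluation of the Fox function\<close>

lemma norm_sin_le_exp: "norm (sin z :: complex) \<le> exp \<bar>Im z\<bar>"
proof -
  have "norm (exp (\<i> * z) - exp (- (\<i> * z))) \<le> exp (- Im z) + exp (Im z)"
    using norm_triangle_ineq4[of "exp (\<i> * z)" "exp (- (\<i> * z))"] by (simp add: norm_exp_eq_Re)
  also have "\<dots> \<le> exp \<bar>Im z\<bar> + exp \<bar>Im z\<bar>" by (intro add_mono) auto
  finally show ?thesis
    unfolding sin_exp_eq by (simp add: norm_divide norm_mult)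
qed

lemma norm_sin_ge_sinh:
  assumes "0 \<le> d" "d \<le> \<bar>Im z\<bar>"
  shows "norm (sin z :: complex) \<ge> sinh d"
proof (rule power2_le_imp_le)
  have "sinh d \<le> sinh \<bar>Im z\<bar>" using assms(2) by (simp only: sinh_real_le_iff)
  hence "(sinh d)\<^sup>2 \<le> (sinh \<bar>Im z\<bar>)\<^sup>2" using assms by (intro power_mono) auto
  also have "\<dots> = (sinh (Im z))\<^sup>2" by (simp add: abs_if)
  also have "\<dots> = (exp (2 * Im z) + inverse (exp (2 * Im z)) - 2) / 4"
    by (simp add: sinh_def power2_eq_square algebra_simps exp_minus inverse_eq_divide field_simps flip: exp_add)
  also have "\<dots> \<le> (norm (sin z))\<^sup>2"
    unfolding norm_sin_squared by (simp add: divide_right_mono)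
  finally show "(sinh d)\<^sup>2 \<le> (norm (sin z))\<^sup>2" .
qed simp

text \<open>Halfway between zeros cos (2 * Re z) = -1, which makes the squared modulus of the sine
  equal to the square of cosh (Im z).\<close>

lemma norm_sin_half_ge_1:
  assumes "Re z = pi * (real k + 1 / 2)"
  shows "norm (sin z :: complex) \<ge> 1"
proof (rule power2_le_imp_le)
  define E where "E = exp (2 * Im z)"
  have E: "E > 0" by (simp add: E_def)
  have "cos (2 * Re z) = cos (pi * of_int (2 * int k + 1))"
    unfolding assms by (rule arg_cong[of _ _ cos]) (simp add: algebra_simps)
  also have "\<dots> = -1"
    using cos_npi[of "2 * k + 1"] by (simp add: mult.commute add.commute)
  finally have c: "cos (2 * Re z) = -1" .
  have "(E - 1)\<^sup>2 \<ge> 0" by simp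
  hence "E * E + 1 \<ge> 2 * E" by (simp add: power2_eq_square algebra_simps)
  hence "E + inverse E \<ge> 2" using E by (simp add: field_simps)
  thus "1\<^sup>2 \<le> (norm (sin z))\<^sup>2"
    unfolding norm_sin_squared c by (simp flip: E_def)
qed simp

lemma rGamma_one_minus_complex:
  fixes z :: complex
  assumes "Re z > 0"
  shows "rGamma (1 - z) = Gamma z * sin (of_real pi * z) / of_real pi"
proof -
  have "z \<notin> \<int>\<^sub>\<le>\<^sub>0" using assms by (auto elim!: nonpos_Ints_cases)
  hence "Gamma z * rGamma z = 1" by (simp add: rGamma_inverse_Gamma Gamma_eq_zero_iff)
  hence "rGamma (1 - z) = Gamma z * (rGamma z * rGamma (1 - z))" by (simp flip: mult.assoc)
  thus ?thesis by (simp add: rGamma_reflection_complex)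
qed

text \<open>The Gamma factors of all three integrands in the common variable w = l * s.\<close>

definition gamma_quotient :: "real \<Rightarrow> complex \<Rightarrow> complex" where
  "gamma_quotient a w = Gamma w / (Gamma (1 + of_real a * w) * Gamma (1 + of_real (1 - a) * w))"

lemma gamma_quotient_altdef:
  "gamma_quotient a w = Gamma w * (rGamma (1 + of_real a * w) * rGamma (1 + of_real (1 - a) * w))"
  by (simp add: gamma_quotient_def rGamma_inverse_Gamma inverse_eq_divide)

text \<open>With r = - Re w, reflecting all three factors leaves, up to constants, Gamma (a * r) *
  Gamma ((1 - a) * r) / Gamma r, a Beta value. The sine from the numerator Gamma ends up in the
  denominator, so w has to stay off the real axis or halfway between poles.\<close>

lemma norm_gamma_quotient_le:
  assumes a: "0 < a" "a < 1" and \<delta>: "\<delta> > 0"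
  shows "\<exists>C. \<forall>w. Re w \<le> -1 \<longrightarrow> \<bar>Im w\<bar> \<le> h \<longrightarrow> \<delta> \<le> \<bar>Im w\<bar> \<or> (\<exists>k::nat. Re w = - (real k + 1 / 2)) \<longrightarrow>
    norm (gamma_quotient a w) \<le> C * (a powr a * (1 - a) powr (1 - a)) powr (- Re w)"
proof -
  define K where "K = a powr a * (1 - a) powr (1 - a)"
  have K: "K > 0" using a by (simp add: K_def)
  define c where "c = norm (Gamma (Complex 1 h))"
  have "Complex 1 h \<notin> \<int>\<^sub>\<le>\<^sub>0" by (auto elim!: nonpos_Ints_cases simp: complex_eq_iff)
  hence c: "c > 0" by (simp add: c_def Gamma_eq_zero_iff)
  define m where "m = min 1 (sinh (pi * \<delta>))"
  have m: "m > 0" using \<delta> by (simp add: m_def)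
  define e where "e = exp (pi * h)"
  show ?thesis
  proof (intro exI allI impI)
    fix w :: complex
    assume w: "Re w \<le> -1" "\<bar>Im w\<bar> \<le> h" "\<delta> \<le> \<bar>Im w\<bar> \<or> (\<exists>k::nat. Re w = - (real k + 1 / 2))"
    define v where "v = - w"
    define r where "r = Re v"
    have r: "r \<ge> 1" and im: "\<bar>Im v\<bar> \<le> h" using w by (auto simp: v_def r_def)
    have pos: "a * r > 0" "(1 - a) * r > 0" using a r by simp_all
    have sin_lower: "norm (sin (of_real pi * v)) \<ge> m"
      using w(3)
    proof
      assume "\<delta> \<le> \<bar>Im w\<bar>"
      hence "sinh (pi * \<delta>) \<le> norm (sin (of_real pi * v))"
        using \<delta> by (intro norm_sin_ge_sinh) (auto simp: v_def abs_mult)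
      thus ?thesis by (simp add: m_def)
    next
      assume "\<exists>k::nat. Re w = - (real k + 1 / 2)"
      then obtain k :: nat where "Re v = real k + 1 / 2" by (auto simp: v_def)
      hence "norm (sin (of_real pi * v)) \<ge> 1"
        by (intro norm_sin_half_ge_1[of _ k]) simp
      thus ?thesis by (simp add: m_def)
    qed
    have G: "norm (Gamma w) \<le> pi / (m * (c * Gamma r))"
    proof -
      have "rGamma (1 + v) * rGamma w = sin (of_real pi * (1 + v)) / of_real pi"
        using rGamma_reflection_complex[of "1 + v"] by (simp add: v_def)
      also have "sin (of_real pi * (1 + v)) = - sin (of_real pi * v)"
        by (simp add: distrib_left sin_add flip: sin_of_real cos_of_real)
      finally have "norm (rGamma (1 + v)) * norm (rGamma w) = norm (sin (of_real pi * v)) / pi"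
        by (simp add: norm_divide flip: norm_mult)
      moreover have "norm (Gamma (1 + v)) * norm (rGamma (1 + v)) = 1"
      proof -
        have "1 + v \<notin> \<int>\<^sub>\<le>\<^sub>0" using r by (auto elim!: nonpos_Ints_cases simp: r_def complex_eq_iff)
        hence "Gamma (1 + v) * rGamma (1 + v) = 1" by (simp add: rGamma_inverse_Gamma Gamma_eq_zero_iff)
        thus ?thesis by (metis norm_mult norm_one)
      qed
      hence "norm (rGamma w) * pi = norm (Gamma (1 + v)) * (norm (rGamma (1 + v)) * norm (rGamma w)) * pi"
        by (simp flip: mult.assoc)
      ultimately have "norm (rGamma w) * pi = norm (sin (of_real pi * v)) * norm (Gamma (1 + v))"
        by simp
      also have "\<dots> \<ge> m * (c * Gamma r)"
      proof (intro mult_mono sin_lower)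
        \<comment> \<open>A factor r is given up so that the three Gamma values combine to a Beta
          value.\<close>
        have "c * Gamma r \<le> c * Gamma (r + 1)"
        proof -
          have "1 * Gamma r \<le> r * Gamma r" using r by (intro mult_right_mono) auto
          also have "r * Gamma r = Gamma (r + 1)" using r
            by (intro Gamma_plus1[symmetric]) (auto elim!: nonpos_Ints_cases)
          finally show ?thesis using c by simp
        qed
        also have "\<dots> \<le> norm (Gamma (1 + v))"
          using norm_Gamma_ge[of "1 + v" h] r im by (simp add: c_def r_def add.commute)
        finally show "c * Gamma r \<le> norm (Gamma (1 + v))" .
      qed (use m c r in auto)
      finally have *: "m * (c * Gamma r) \<le> norm (rGamma w) * pi" .
      have p: "m * (c * Gamma r) > 0" using m c r by (intro mult_pos_pos Gamma_real_pos) auto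
      hence "norm (rGamma w) > 0" using less_le_trans[OF p *] by (simp add: zero_less_mult_iff)
      moreover have "norm (Gamma w) = inverse (norm (rGamma w))"
        by (simp add: rGamma_inverse_Gamma norm_inverse)
      moreover have "inverse N \<le> pi / X" if "N > 0" "X > 0" "X \<le> N * pi" for N X :: real
        using that by (simp add: field_simps)
      ultimately show ?thesis using * p by simp
    qed
    have R: "norm (rGamma (1 + of_real b * w)) \<le> Gamma (b * r) * e / pi" if b: "0 < b" "b < 1" for b
    proof -
      have br: "b * r > 0" using b r by simp
      have "norm (rGamma (1 + of_real b * w)) = norm (Gamma (of_real b * v)) * norm (sin (of_real pi * (of_real b * v))) / pi"
        using rGamma_one_minus_complex[of "of_real b * v"] br
        by (simp add: v_def r_def norm_divide norm_mult)
      also have "\<dots> \<le> Gamma (b * r) * e / pi"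
      proof (intro divide_right_mono mult_mono)
        show "norm (Gamma (of_real b * v)) \<le> Gamma (b * r)"
          using norm_Gamma_le[of "of_real b * v"] br by (simp add: r_def)
        have "norm (sin (of_real pi * (of_real b * v))) \<le> exp \<bar>pi * (b * Im v)\<bar>"
          using norm_sin_le_exp[of "of_real pi * (of_real b * v)"] by simp
        also have "\<bar>pi * (b * Im v)\<bar> \<le> pi * (1 * h)"
          using b im unfolding abs_mult by (intro mult_mono) auto
        finally show "norm (sin (of_real pi * (of_real b * v))) \<le> e" by (simp add: e_def)
      qed (use br in auto)
      finally show ?thesis .
    qed
    have "0 \<le> Gamma (a * r) * e / pi" using pos by (simp add: e_def)
    hence "norm (gamma_quotient a w) \<le>
        pi / (m * (c * Gamma r)) * ((Gamma (a * r) * e / pi) * (Gamma ((1 - a) * r) * e / pi))"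
      unfolding gamma_quotient_altdef norm_mult
      using R[of a] R[of "1 - a"] a r c m by (intro mult_mono G) auto
    also have "\<dots> = e\<^sup>2 / (m * c * pi) * Beta (a * r) ((1 - a) * r)"
      using m c by (simp add: Beta_def power2_eq_square algebra_simps)
    also have "\<dots> \<le> e\<^sup>2 / (m * c * pi) * (K powr (r - 1) * Beta a (1 - a))"
      using Beta_scaled_le[OF a r] m c unfolding K_def by (intro mult_left_mono) auto
    also have "K powr (r - 1) = K powr (- Re w) / K"
      using K by (simp add: powr_diff r_def v_def)
    finally show "norm (gamma_quotient a w) \<le> (e\<^sup>2 / (m * c * pi) * Beta a (1 - a) / K) *
        (a powr a * (1 - a) powr (1 - a)) powr (- Re w)"
      by (simp add: K_def mult_ac)
  qed
qed

text \<open>For z = y powr (-l) the factor z powr (-s) is y powr (l * s), so l enters only through w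
  = l * s. The change of variable divides each residue by l.\<close>

lemma fox_H_eq_series:
  fixes a l y S :: real
  assumes a: "0 < a" "a < 1" and y: "y > a powr a * (1 - a) powr (1 - a)" and l: "l > 0"
    and S: "(\<lambda>n. (-1) ^ n / fact n * rGamma (1 - a * n) * rGamma (1 - (1 - a) * n) / y ^ n) sums S"
  shows "fox_H (y powr (- l)) (1, l * a) (1, l * (1 - a)) (0, l) = of_real (S / l)"
proof (rule fox_H_eqI)
  define K where "K = a powr a * (1 - a) powr (1 - a)"
  have K: "K > 0" using a by (simp add: K_def)
  have y0: "y > 0" using y K by (simp add: K_def)
  \<comment> \<open>The growth K powr (- l * Re s) of the Gamma factors competes with y powr (l * Re
    s); \<kappa> > 0 says precisely that y > K.\<close>
  define \<kappa> where "\<kappa> = l * ln (y / K)"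
  have \<kappa>: "\<kappa> > 0" using y K l by (simp add: \<kappa>_def K_def)
  have poles: "Gamma_poles (0, l) = scaled_nonpos_Ints l"
    by (simp add: Gamma_poles_def scaled_nonpos_Ints_def)
  show "\<exists>g. left_loop (Gamma_poles (0, l)) g"
    unfolding poles scaled_nonpos_Ints_eq[OF l] using l by (intro left_loop_exists) auto
  define f where "f = fox_integrand (y powr (- l)) (1, l * a) (1, l * (1 - a)) (0, l)"
  have f: "f s = gamma_quotient a (of_real l * s) * exp (of_real l * s * of_real (ln y))" for s
    using y0 by (simp add: f_def fox_integrand_def gamma_quotient_def ln_powr mult_ac)
  have hol: "f holomorphic_on A" if "A \<inter> scaled_nonpos_Ints l = {}" for A
    unfolding f[abs_def] gamma_quotient_altdef using that
    by (intro holomorphic_intros) (auto simp: scaled_nonpos_Ints_def)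
  fix g assume g: "left_loop (Gamma_poles (0, l)) g"
  define r where "r n = complex_of_real
    ((-1) ^ n / fact n * rGamma (1 - a * n) * rGamma (1 - (1 - a) * n) / y ^ n / l)" for n
  have "has_improper_contour_integral f (2 * of_real pi * \<i> * of_real (S / l)) g"
  proof (rule left_loop_has_improper_contour_integral[OF l \<kappa>])
    show "f holomorphic_on - scaled_nonpos_Ints l" by (rule hol) auto
    show "left_loop (scaled_nonpos_Ints l) g" using g by (simp add: poles)
    show "r sums of_real (S / l)" unfolding r_def by (intro sums_of_real sums_divide S)
  next
    fix h \<delta> :: real assume \<delta>: "\<delta> > 0"
    obtain C where C: "\<And>w. Re w \<le> -1 \<Longrightarrow> \<bar>Im w\<bar> \<le> l * h \<Longrightarrow>
        l * \<delta> \<le> \<bar>Im w\<bar> \<or> (\<exists>k::nat. Re w = - (real k + 1 / 2)) \<Longrightarrow>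
        norm (gamma_quotient a w) \<le> C * K powr (- Re w)"
      using norm_gamma_quotient_le[OF a, of "l * \<delta>" "l * h"] \<delta> l unfolding K_def by auto
    show "\<exists>C R. \<forall>w. Re w \<le> R \<longrightarrow> \<bar>Im w\<bar> \<le> h \<longrightarrow>
        \<delta> \<le> \<bar>Im w\<bar> \<or> (\<exists>k::nat. Re w = - (real k + 1 / 2) / l) \<longrightarrow> norm (f w) \<le> C * exp (\<kappa> * Re w)"
    proof (intro exI allI impI)
      fix w :: complex
      assume w: "Re w \<le> - 1 / l" "\<bar>Im w\<bar> \<le> h"
        "\<delta> \<le> \<bar>Im w\<bar> \<or> (\<exists>k::nat. Re w = - (real k + 1 / 2) / l)"
      have "norm (gamma_quotient a (of_real l * w)) \<le> C * K powr (- Re (of_real l * w))"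
        using w l by (intro C) (auto simp: field_simps abs_mult)
      hence "norm (f w) \<le> C * K powr (- Re (of_real l * w)) * exp (l * Re w * ln y)"
        unfolding f norm_mult by (simp add: norm_exp_eq_Re mult_right_mono)
      also have "\<dots> = C * exp (\<kappa> * Re w)"
        using K y0 by (simp add: powr_def \<kappa>_def ln_div algebra_simps flip: exp_add)
      finally show "norm (f w) \<le> C * exp (\<kappa> * Re w)" .
    qed
  next
    fix n :: nat
    define p where "p = - complex_of_real (real n / l)"
    have lp: "of_real l * p = - of_nat n" using l by (simp add: p_def)
    show "residue f (- of_real (real n / l)) = r n"
      unfolding p_def[symmetric]
    proof (rule residue_simple'[of "ball p (1 / l)"])
      \<comment> \<open>The radius 1 / l is the distance between neighbouring poles, so the open
        ball contains only p.\<close>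
      show "f holomorphic_on ball p (1 / l) - {p}"
      proof (rule hol, safe)
        fix s assume s: "s \<in> ball p (1 / l)" "s \<in> scaled_nonpos_Ints l" "s \<notin> {}"
        then obtain j where j: "s = - of_real (real j / l)"
          unfolding scaled_nonpos_Ints_eq[OF l] by blast
        have "p - s = of_real ((real j - real n) / l)" by (simp add: p_def j diff_divide_distrib)
        hence "norm (p - s) = \<bar>real j - real n\<bar> / l" using l by (simp only: norm_of_real) simp
        hence "\<bar>real j - real n\<bar> < 1" using s(1) l by (simp add: dist_norm field_simps)
        hence "j = n" by linarith
        thus "s = p" by (simp add: j p_def)
      qed
      have fl: "filterlim (\<lambda>s. of_real l * s) (at (- of_nat n :: complex)) (at p)"
      proof (rule filterlim_atI)
        show "((\<lambda>s. of_real l * s) \<longlongrightarrow> - of_nat n) (at p)"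
          unfolding lp[symmetric] by (intro tendsto_intros)
        show "eventually (\<lambda>s. of_real l * s \<noteq> (- of_nat n :: complex)) (at p)"
          unfolding lp[symmetric] using l by (auto simp: eventually_at_filter)
      qed
      have "((\<lambda>s. Gamma (of_real l * s) * (of_real l * s + of_nat n)) \<longlongrightarrow> (-1) ^ n / fact n) (at p)"
        by (rule filterlim_compose[OF Gamma_residues fl])
      hence "((\<lambda>s. Gamma (of_real l * s) * (of_real l * s + of_nat n) / of_real l *
          (rGamma (1 + of_real a * (of_real l * s)) * rGamma (1 + of_real (1 - a) * (of_real l * s))) *
          exp (of_real l * s * of_real (ln y))) \<longlongrightarrow> (-1) ^ n / fact n / of_real l *
          (rGamma (1 + of_real a * (of_real l * p)) * rGamma (1 + of_real (1 - a) * (of_real l * p))) *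
          exp (of_real l * p * of_real (ln y))) (at p)"
        using l by (intro tendsto_intros isCont_tendsto_compose[OF isCont_rGamma[of _ "\<lambda>z. z"]]) auto
      also have "(-1) ^ n / fact n / of_real l *
          (rGamma (1 + of_real a * (of_real l * p)) * rGamma (1 + of_real (1 - a) * (of_real l * p))) *
          exp (of_real l * p * of_real (ln y)) = r n"
      proof -
        have "exp (of_real l * p * of_real (ln y)) = complex_of_real (exp (- (real n * ln y)))"
          unfolding lp by (simp flip: exp_of_real)
        also have "exp (- (real n * ln y)) = 1 / y ^ n"
          using y0 by (simp add: exp_minus exp_of_nat_mult inverse_eq_divide)
        finally have e: "exp (of_real l * p * of_real (ln y)) = complex_of_real (1 / y ^ n)" .
        have g: "rGamma (1 + of_real b * (of_real l * p)) = complex_of_real (rGamma (1 - b * n))" for b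
          unfolding lp by (simp flip: rGamma_complex_of_real)
        show ?thesis unfolding e g r_def by (simp add: mult_ac)
      qed
      also have "(\<lambda>s. Gamma (of_real l * s) * (of_real l * s + of_nat n) / of_real l *
          (rGamma (1 + of_real a * (of_real l * s)) * rGamma (1 + of_real (1 - a) * (of_real l * s))) *
          exp (of_real l * s * of_real (ln y))) = (\<lambda>s. f s * (s - p))"
      proof
        fix s
        have e: "s - p = (of_real l * s + of_nat n) / of_real l"
          using l by (simp add: p_def field_simps)
        show "Gamma (of_real l * s) * (of_real l * s + of_nat n) / of_real l *
          (rGamma (1 + of_real a * (of_real l * s)) * rGamma (1 + of_real (1 - a) * (of_real l * s))) *
          exp (of_real l * s * of_real (ln y)) = f s * (s - p)"
          unfolding f gamma_quotient_altdef e times_divide_eq_right times_divide_eq_left by (simp only: mult_ac)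
      qed
      finally show "((\<lambda>s. f s * (s - p)) \<longlongrightarrow> r n) (at p)" .
    qed (use l in auto)
  qed
  thus "has_improper_contour_integral (fox_integrand (y powr (- l)) (1, l * a) (1, l * (1 - a)) (0, l))
      (2 * of_real pi * \<i> * of_real (S / l)) g" by (simp add: f_def)
qed

section \<open>The distribution function\<close>

text \<open>The outer exponent of \<open>a_fun (1 - a)\<close> is 1 / a, so all comparisons may be
  made for \<open>b_fun\<close> at y = x powr a.\<close>

lemma a_fun_le_iff:
  assumes a: "0 < a" "a < 1" and x: "x > 0" and v: "0 < v" "v < pi"
  shows "a_fun (1 - a) v \<le> x \<longleftrightarrow> b_fun (1 - a) v \<le> x powr a"
proof -
  have b: "b_fun (1 - a) v > 0"
    using b_fun_eq_exp(1)[of "1 - a" v] a v by simp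
  have "a_fun (1 - a) v \<ge> 0" by (simp add: a_fun_def)
  hence "a_fun (1 - a) v \<le> x \<longleftrightarrow> a_fun (1 - a) v powr a \<le> x powr a"
    using powr_mono2[of a "a_fun (1 - a) v" x] powr_less_mono2[of a x "a_fun (1 - a) v"] a x
    by (meson less_imp_le not_le)
  thus ?thesis using a b by (simp add: a_fun_def powr_powr)
qed

theorem mainTheorem3:
  fixes \<alpha> :: real and M :: "'w measure" and V :: "'w \<Rightarrow> real"
  assumes "0 < \<alpha>" and "\<alpha> < 1"
    and "prob_space M"
    and "V \<in> borel_measurable M"
    and "distr M lborel V = uniform_measure lborel {0<..<1}"
  defines "F \<equiv> \<lambda>x. measure M {\<omega> \<in> space M. a_fun (1 - \<alpha>) (pi * V \<omega>) \<le> x}"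
  shows "(\<forall>x > \<alpha> * (1 - \<alpha>) powr ((1 - \<alpha>) / \<alpha>).
           1 / pi * a_inv (1 - \<alpha>) x = F x \<and>
           complex_of_real (F x) =
             2 * fox_H (1 / x powr (2 * \<alpha>)) (1, 2 * \<alpha>) (1, 2 * (1 - \<alpha>)) (0, 2) \<and>
           complex_of_real (F x) =
             complex_of_real (1 / \<alpha>) *
               fox_H (1 / x) (1, 1) (1, (1 - \<alpha>) / \<alpha>) (0, 1 / \<alpha>) \<and>
           complex_of_real (F x) =
             complex_of_real (1 / (1 - \<alpha>)) *
               fox_H (1 / x powr (\<alpha> / (1 - \<alpha>))) (1, \<alpha> / (1 - \<alpha>)) (1, 1) (0, 1 / (1 - \<alpha>))) \<and>
         (\<forall>x \<le> \<alpha> * (1 - \<alpha>) powr ((1 - \<alpha>) / \<alpha>). F x = 0)"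
proof -
  note a = assms(1,2)
  define K where "K = \<alpha> powr \<alpha> * (1 - \<alpha>) powr (1 - \<alpha>)"
  define x0 where "x0 = \<alpha> * (1 - \<alpha>) powr ((1 - \<alpha>) / \<alpha>)"
  have x0: "x0 > 0" using a by (simp add: x0_def)
  \<comment> \<open>The threshold for x thus becomes y > K, the condition for convergence of the
    series.\<close>
  have x0_powr: "x0 powr \<alpha> = K"
    using a by (simp add: x0_def K_def powr_mult powr_powr)
  have K_powr: "K powr (1 / \<alpha>) = x0"
    using a x0 by (simp flip: x0_powr add: powr_powr)
  have F_eq: "F x = measure lborel ({0<..<1} \<inter> {v. a_fun (1 - \<alpha>) (pi * v) \<le> x})" for x
  proof -
    have "{v. a_fun (1 - \<alpha>) (pi * v) \<le> x} \<in> sets borel"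
      unfolding a_fun_def b_fun_def c_fun_def by measurable
    hence m: "{v. a_fun (1 - \<alpha>) (pi * v) \<le> x} \<in> sets lborel" by simp
    have "V \<in> measurable M lborel" using assms(4) by simp
    hence "measure (distr M lborel V) {v. a_fun (1 - \<alpha>) (pi * v) \<le> x} =
        measure M (V -` {v. a_fun (1 - \<alpha>) (pi * v) \<le> x} \<inter> space M)"
      using m by (rule measure_distr)
    also have "V -` {v. a_fun (1 - \<alpha>) (pi * v) \<le> x} \<inter> space M =
        {\<omega> \<in> space M. a_fun (1 - \<alpha>) (pi * V \<omega>) \<le> x}" by auto
    finally show ?thesis
      unfolding F_def assms(5) using m by (subst (asm) measure_uniform_measure) auto
  qed
  have upper: "1 / pi * a_inv (1 - \<alpha>) x = F x \<and>
           complex_of_real (F x) =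
             2 * fox_H (1 / x powr (2 * \<alpha>)) (1, 2 * \<alpha>) (1, 2 * (1 - \<alpha>)) (0, 2) \<and>
           complex_of_real (F x) =
             complex_of_real (1 / \<alpha>) *
               fox_H (1 / x) (1, 1) (1, (1 - \<alpha>) / \<alpha>) (0, 1 / \<alpha>) \<and>
           complex_of_real (F x) =
             complex_of_real (1 / (1 - \<alpha>)) *
               fox_H (1 / x powr (\<alpha> / (1 - \<alpha>))) (1, \<alpha> / (1 - \<alpha>)) (1, 1) (0, 1 / (1 - \<alpha>))"
    if x: "x > x0" for x
  proof -
    have xpos: "x > 0" using x x0 by simp
    define y where "y = x powr \<alpha>"
    have "x0 powr \<alpha> < x powr \<alpha>" using x x0 a by (intro powr_less_mono2) auto
    hence y: "y > K" by (simp add: x0_powr y_def)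
    obtain u where u: "0 < u" "u < pi" "b_fun (1 - \<alpha>) u = y"
      "(\<lambda>n. (-1) ^ n / fact n * rGamma (1 - \<alpha> * n) * rGamma (1 - (1 - \<alpha>) * n) / y ^ n) sums (u / pi)"
      using angle_series[OF a y[unfolded K_def]] by blast
    have b_le: "b_fun (1 - \<alpha>) v \<le> y \<longleftrightarrow> v \<le> u" if "0 < v" "v < pi" for v
      using b_fun_strict_mono[of "1 - \<alpha>" v u] b_fun_strict_mono[of "1 - \<alpha>" u v] a u that
      by (cases v u rule: linorder_cases) auto
    have "{0<..<1} \<inter> {v. a_fun (1 - \<alpha>) (pi * v) \<le> x} = {0<..u / pi}"
    proof -
      have "a_fun (1 - \<alpha>) (pi * v) \<le> x \<longleftrightarrow> v \<le> u / pi" if "0 < v" "v < 1" for v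
        using a_fun_le_iff[OF a xpos, of "pi * v"] b_le[of "pi * v"] that
        by (simp add: y_def field_simps)
      moreover have "v < 1" if "v \<le> u / pi" for v
      proof -
        have "u / pi < 1" using u(2) by simp
        thus ?thesis using that by linarith
      qed
      ultimately show ?thesis by (intro set_eqI) (metis IntD1 IntD2 IntI greaterThanAtMost_iff greaterThanLessThan_iff mem_Collect_eq)
    qed
    hence Fx: "F x = u / pi" using u by (simp add: F_eq)
    have "inj_on (a_fun (1 - \<alpha>)) {0<..<pi}"
    proof (rule inj_onI)
      have lt: "a_fun (1 - \<alpha>) v < a_fun (1 - \<alpha>) w" if "0 < v" "v < w" "w < pi" for v w
        using b_fun_strict_mono[of "1 - \<alpha>" v w] b_fun_eq_exp(1)[of "1 - \<alpha>" v] a that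
        unfolding a_fun_def by (intro powr_less_mono2) auto
      show "v = w" if "v \<in> {0<..<pi}" "w \<in> {0<..<pi}" "a_fun (1 - \<alpha>) v = a_fun (1 - \<alpha>) w" for v w
        using lt[of v w] lt[of w v] that by (cases v w rule: linorder_cases) auto
    qed
    moreover have "a_fun (1 - \<alpha>) u = x"
      unfolding a_fun_def u(3) using a xpos by (simp add: y_def powr_powr)
    ultimately have inv: "a_inv (1 - \<alpha>) x = u"
      unfolding a_inv_def using u by (intro the_inv_into_f_eq) auto
    \<comment> \<open>One series value u / pi serves for every l; the prefactors 2, 1 / \<alpha> and
      1 / (1 - \<alpha>) in the theorem are the values of l that undo the division by l.\<close>
    note H = fox_H_eq_series[OF a y[unfolded K_def] _ u(4)]
    have "y powr (- 2) = 1 / x powr (2 * \<alpha>)" "y powr (- (1 / \<alpha>)) = 1 / x"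
      "y powr (- (1 / (1 - \<alpha>))) = 1 / x powr (\<alpha> / (1 - \<alpha>))"
      using a xpos by (simp_all add: y_def powr_powr powr_minus_divide mult.commute)
    thus ?thesis
      using H[of 2] H[of "1 / \<alpha>"] H[of "1 / (1 - \<alpha>)"] a inv by (simp add: Fx)
  qed
  have lower: "F x = 0" if x: "x \<le> x0" for x
  proof -
    \<comment> \<open>The bound is strict, so the event is empty even at x = x0.\<close>
    have "a_fun (1 - \<alpha>) (pi * v) > x0" if "0 < v" "v < 1" for v
    proof -
      have "K < b_fun (1 - \<alpha>) (pi * v)"
        using b_fun_gt[of "1 - \<alpha>" "pi * v"] a that by (simp add: K_def mult.commute)
      hence "K powr (1 / \<alpha>) < b_fun (1 - \<alpha>) (pi * v) powr (1 / \<alpha>)"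
        using a by (intro powr_less_mono2) (auto simp: K_def)
      thus ?thesis using K_powr by (simp add: a_fun_def)
    qed
    hence "{0<..<1} \<inter> {v. a_fun (1 - \<alpha>) (pi * v) \<le> x} = {}" using x by fastforce
    thus ?thesis by (simp add: F_eq)
  qed
  show ?thesis using upper lower unfolding x0_def by blast
qed

end
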